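(* Let $\mathcal{H}$ be a pre-Hilbert category whose monoidal unit $C$ is a simple generator. Let $f:X\to Y$ and $g:Y\to X$ be morphisms such that $(f^\perp)^{\mathrm{op}}\dashv g^\perp$, i.e. for all $M\in\mathrm{ClSub}(X)$ and $N\in\mathrm{ClSub}(Y)$, $N\le(\exists_f M)^\perp$ if and only if $M\le(\exists_g N)^\perp$. Then $g=s\bullet f^\dagger$ for some scalar $s:C\to C$. Unless $f=0$, this $s$ is unique.
   Context: A $\dagger$-category is a category $\mathcal{H}$ with a functor $\dagger:\mathcal{H}^{\mathrm{op}}\to\mathcal{H}$ that is the identity on objects with $f^{\dagger\dagger}=f$. A morphism $m$ is a $\dagger$-mono if $m^\dagger m=\mathrm{id}$, a $\dagger$-epi if $mm^\dagger=\mathrm{id}$. A pre-Hilbert category is a $\dagger$-category such that: it has finite $\dagger$-biproducts (finite biproducts, including a zero object $0$, with $\pi^\dagger=\kappa$); it has finite $\dagger$-equalisers (equalisers that are $\dagger$-monos); every $\dagger$-mono is a kernel of some morphism; and it is symmetric $\dagger$-monoidal ($(f\otimes g)^\dagger=f^\dagger\otimes g^\dagger$, coherence isomorphisms $\dagger$-isos), with monoidal unit $C$. $C$ is a generator if for all $f,g:X\to Y$, $fx=gx$ for all $x:C\to X$ implies $f=g$; it is simple if its only subobjects are $0$ and $C$. Kernels are chosen to be $\dagger$-monos. A subobject of $X$ is an equivalence class of monos into $X$ (modulo isomorphism of domains commuting with the monos), ordered by factorisation; $\mathrm{ClSub}(X)$ is the poset of subobjects representable by a $\dagger$-mono. Every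 morphism $h$ factors as $h=me$ with $e$ epi and $m$ a $\dagger$-mono; $\mathrm{Im}(h)$ is the subobject represented by $m$. For $f:X\to Y$, $\exists_f(M)=\mathrm{Im}(f\circ m)$, and $f^\perp=\perp_Y\circ\exists_f^{\mathrm{op}}$, where $\perp$ sends $m$ to $m^\perp=\ker(m^\dagger)$. A scalar is a morphism $s:C\to C$; for $h:X\to Y$, $s\bullet h=\lambda_Y\circ(s\otimes h)\circ\lambda_X^{-1}$ where $\lambda_X:C\otimes X\to X$ is the left unitor. *)

theory Defs
  imports Main
begin

section \<open>Categories\<close>

text \<open>A category is given by a carrier of objects and a carrier of arrows; the operations are only
  constrained on these carriers. Composition is written in the usual order: \<open>g \<cdot> f\<close> is
  \<open>f\<close> followed by \<open>g\<close>.\<close>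

record ('o, 'a) category =
  Obj :: "'o set"
  Arr :: "'a set"
  Dom :: "'a \<Rightarrow> 'o"
  Cod :: "'a \<Rightarrow> 'o"
  Id :: "'o \<Rightarrow> 'a"
  Comp :: "'a \<Rightarrow> 'a \<Rightarrow> 'a"  (infixl "\<cdot>\<index>" 70)

definition hom :: "('o, 'a, 'z) category_scheme \<Rightarrow> 'o \<Rightarrow> 'o \<Rightarrow> 'a set" where
  "hom H X Y = {f \<in> Arr H. Dom H f = X \<and> Cod H f = Y}"

locale category =
  fixes H :: "('o, 'a, 'z) category_scheme" (structure)
  assumes Dom_Obj: "f \<in> Arr H \<Longrightarrow> Dom H f \<in> Obj H"
    and Cod_Obj: "f \<in> Arr H \<Longrightarrow> Cod H f \<in> Obj H"
    and Id_hom: "X \<in> Obj H \<Longrightarrow> Id H X \<in> hom H X X"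
    and Comp_hom: "f \<in> hom H X Y \<Longrightarrow> g \<in> hom H Y Z \<Longrightarrow> g \<cdot> f \<in> hom H X Z"
    and Comp_Id: "f \<in> hom H X Y \<Longrightarrow> f \<cdot> Id H X = f"
    and Id_Comp: "f \<in> hom H X Y \<Longrightarrow> Id H Y \<cdot> f = f"
    and Comp_assoc: "f \<in> hom H W X \<Longrightarrow> g \<in> hom H X Y \<Longrightarrow> h \<in> hom H Y Z \<Longrightarrow>
      (h \<cdot> g) \<cdot> f = h \<cdot> (g \<cdot> f)"

definition mono_arr :: "('o, 'a, 'z) category_scheme \<Rightarrow> 'a \<Rightarrow> bool" where
  "mono_arr H m \<longleftrightarrow> m \<in> Arr H \<and>
    (\<forall>W\<in>Obj H. \<forall>u\<in>hom H W (Dom H m). \<forall>v\<in>hom H W (Dom H m).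
      m \<cdot>\<^bsub>H\<^esub> u = m \<cdot>\<^bsub>H\<^esub> v \<longrightarrow> u = v)"

definition epi_arr :: "('o, 'a, 'z) category_scheme \<Rightarrow> 'a \<Rightarrow> bool" where
  "epi_arr H e \<longleftrightarrow> e \<in> Arr H \<and>
    (\<forall>W\<in>Obj H. \<forall>u\<in>hom H (Cod H e) W. \<forall>v\<in>hom H (Cod H e) W.
      u \<cdot>\<^bsub>H\<^esub> e = v \<cdot>\<^bsub>H\<^esub> e \<longrightarrow> u = v)"

definition inverse_arrs :: "('o, 'a, 'z) category_scheme \<Rightarrow> 'a \<Rightarrow> 'a \<Rightarrow> bool" where
  "inverse_arrs H f g \<longleftrightarrow> f \<in> Arr H \<and> g \<in> hom H (Cod H f) (Dom H f) \<and>
    g \<cdot>\<^bsub>H\<^esub> f = Id H (Dom H f) \<and> f \<cdot>\<^bsub>H\<^esub> g = Id H (Cod H f)"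

definition iso_arr :: "('o, 'a, 'z) category_scheme \<Rightarrow> 'a \<Rightarrow> bool" where
  "iso_arr H f \<longleftrightarrow> (\<exists>g. inverse_arrs H f g)"

definition inv_arr :: "('o, 'a, 'z) category_scheme \<Rightarrow> 'a \<Rightarrow> 'a" where
  "inv_arr H f = (THE g. inverse_arrs H f g)"

definition zero_object :: "('o, 'a, 'z) category_scheme \<Rightarrow> 'o \<Rightarrow> bool" where
  "zero_object H Z \<longleftrightarrow> Z \<in> Obj H \<and>
    (\<forall>X\<in>Obj H. (\<exists>!f. f \<in> hom H X Z) \<and> (\<exists>!f. f \<in> hom H Z X))"

definition zero_arr :: "('o, 'a, 'z) category_scheme \<Rightarrow> 'o \<Rightarrow> 'o \<Rightarrow> 'a" where
  "zero_arr H X Y = (THE f. \<exists>Z u v. zero_object H Z \<and> u \<in> hom H X Z \<and> v \<in> hom H Z Y \<and>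
    f = v \<cdot>\<^bsub>H\<^esub> u)"

definition equaliser :: "('o, 'a, 'z) category_scheme \<Rightarrow> 'a \<Rightarrow> 'a \<Rightarrow> 'a \<Rightarrow> bool" where
  "equaliser H e f g \<longleftrightarrow> e \<in> Arr H \<and> f \<in> hom H (Cod H e) (Cod H f) \<and> g \<in> hom H (Cod H e) (Cod H f) \<and>
    f \<cdot>\<^bsub>H\<^esub> e = g \<cdot>\<^bsub>H\<^esub> e \<and>
    (\<forall>W\<in>Obj H. \<forall>h\<in>hom H W (Cod H e). f \<cdot>\<^bsub>H\<^esub> h = g \<cdot>\<^bsub>H\<^esub> h \<longrightarrow>
      (\<exists>!u. u \<in> hom H W (Dom H e) \<and> e \<cdot>\<^bsub>H\<^esub> u = h))"

definition kernel :: "('o, 'a, 'z) category_scheme \<Rightarrow> 'a \<Rightarrow> 'a \<Rightarrow> bool" where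
  "kernel H k f \<longleftrightarrow> equaliser H k f (zero_arr H (Dom H f) (Cod H f))"

definition product_cone ::
  "('o, 'a, 'z) category_scheme \<Rightarrow> 'o \<Rightarrow> 'o \<Rightarrow> 'o \<Rightarrow> 'a \<Rightarrow> 'a \<Rightarrow> bool" where
  "product_cone H X Y B p q \<longleftrightarrow> p \<in> hom H B X \<and> q \<in> hom H B Y \<and>
    (\<forall>W\<in>Obj H. \<forall>f\<in>hom H W X. \<forall>g\<in>hom H W Y.
      \<exists>!h. h \<in> hom H W B \<and> p \<cdot>\<^bsub>H\<^esub> h = f \<and> q \<cdot>\<^bsub>H\<^esub> h = g)"

definition coproduct_cocone ::
  "('o, 'a, 'z) category_scheme \<Rightarrow> 'o \<Rightarrow> 'o \<Rightarrow> 'o \<Rightarrow> 'a \<Rightarrow> 'a \<Rightarrow> bool" where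
  "coproduct_cocone H X Y B i j \<longleftrightarrow> i \<in> hom H X B \<and> j \<in> hom H Y B \<and>
    (\<forall>W\<in>Obj H. \<forall>f\<in>hom H X W. \<forall>g\<in>hom H Y W.
      \<exists>!h. h \<in> hom H B W \<and> h \<cdot>\<^bsub>H\<^esub> i = f \<and> h \<cdot>\<^bsub>H\<^esub> j = g)"

definition biproduct ::
  "('o, 'a, 'z) category_scheme \<Rightarrow> 'o \<Rightarrow> 'o \<Rightarrow> 'o \<Rightarrow> 'a \<Rightarrow> 'a \<Rightarrow> 'a \<Rightarrow> 'a \<Rightarrow> bool" where
  "biproduct H X Y B p q i j \<longleftrightarrow> product_cone H X Y B p q \<and> coproduct_cocone H X Y B i j \<and>
    p \<cdot>\<^bsub>H\<^esub> i = Id H X \<and> q \<cdot>\<^bsub>H\<^esub> j = Id H Y \<and>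
    q \<cdot>\<^bsub>H\<^esub> i = zero_arr H X Y \<and> p \<cdot>\<^bsub>H\<^esub> j = zero_arr H Y X"

definition generator :: "('o, 'a, 'z) category_scheme \<Rightarrow> 'o \<Rightarrow> bool" where
  "generator H C \<longleftrightarrow> C \<in> Obj H \<and>
    (\<forall>X\<in>Obj H. \<forall>Y\<in>Obj H. \<forall>f\<in>hom H X Y. \<forall>g\<in>hom H X Y.
      (\<forall>x\<in>hom H C X. f \<cdot>\<^bsub>H\<^esub> x = g \<cdot>\<^bsub>H\<^esub> x) \<longrightarrow> f = g)"

section \<open>Subobjects\<close>

definition monos_into :: "('o, 'a, 'z) category_scheme \<Rightarrow> 'o \<Rightarrow> 'a set" where
  "monos_into H X = {m. mono_arr H m \<and> Cod H m = X}"

definition same_subobject :: "('o, 'a, 'z) category_scheme \<Rightarrow> 'o \<Rightarrow> ('a \<times> 'a) set" where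
  "same_subobject H X = {(m, n). m \<in> monos_into H X \<and> n \<in> monos_into H X \<and>
    (\<exists>u. iso_arr H u \<and> u \<in> hom H (Dom H m) (Dom H n) \<and> m = n \<cdot>\<^bsub>H\<^esub> u)}"

definition Sub :: "('o, 'a, 'z) category_scheme \<Rightarrow> 'o \<Rightarrow> 'a set set" where
  "Sub H X = monos_into H X // same_subobject H X"

definition subobject_of :: "('o, 'a, 'z) category_scheme \<Rightarrow> 'a \<Rightarrow> 'a set" where
  "subobject_of H m = same_subobject H (Cod H m) `` {m}"

definition sub_le :: "('o, 'a, 'z) category_scheme \<Rightarrow> 'a set \<Rightarrow> 'a set \<Rightarrow> bool" where
  "sub_le H M N \<longleftrightarrow> (\<exists>m\<in>M. \<exists>n\<in>N. \<exists>u\<in>hom H (Dom H m) (Dom H n). m = n \<cdot>\<^bsub>H\<^esub> u)"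

definition simple_object :: "('o, 'a, 'z) category_scheme \<Rightarrow> 'o \<Rightarrow> bool" where
  "simple_object H X \<longleftrightarrow> X \<in> Obj H \<and>
    (\<forall>S\<in>Sub H X. (\<exists>Z. zero_object H Z \<and> S = subobject_of H (zero_arr H Z X)) \<or>
      S = subobject_of H (Id H X))"

section \<open>Dagger categories\<close>

record ('o, 'a) dagger_category = "('o, 'a) category" +
  Dagger :: "'a \<Rightarrow> 'a"  ("_\<^sup>\<dagger>\<index>" [1000] 999)

locale dagger_category = category H
  for H :: "('o, 'a, 'z) dagger_category_scheme" (structure) +
  assumes Dagger_hom: "f \<in> hom H X Y \<Longrightarrow> f\<^sup>\<dagger> \<in> hom H Y X"
    and Dagger_Id: "X \<in> Obj H \<Longrightarrow> (Id H X)\<^sup>\<dagger> = Id H X"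
    and Dagger_Comp: "f \<in> hom H X Y \<Longrightarrow> g \<in> hom H Y Z \<Longrightarrow> (g \<cdot> f)\<^sup>\<dagger> = f\<^sup>\<dagger> \<cdot> g\<^sup>\<dagger>"
    and Dagger_Dagger: "f \<in> Arr H \<Longrightarrow> (f\<^sup>\<dagger>)\<^sup>\<dagger> = f"

definition dagger_mono :: "('o, 'a, 'z) dagger_category_scheme \<Rightarrow> 'a \<Rightarrow> bool" where
  "dagger_mono H m \<longleftrightarrow> m \<in> Arr H \<and> m\<^sup>\<dagger>\<^bsub>H\<^esub> \<cdot>\<^bsub>H\<^esub> m = Id H (Dom H m)"

definition dagger_epi :: "('o, 'a, 'z) dagger_category_scheme \<Rightarrow> 'a \<Rightarrow> bool" where
  "dagger_epi H m \<longleftrightarrow> m \<in> Arr H \<and> m \<cdot>\<^bsub>H\<^esub> m\<^sup>\<dagger>\<^bsub>H\<^esub> = Id H (Cod H m)"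

definition dagger_iso :: "('o, 'a, 'z) dagger_category_scheme \<Rightarrow> 'a \<Rightarrow> bool" where
  "dagger_iso H m \<longleftrightarrow> dagger_mono H m \<and> dagger_epi H m"

definition ClSub :: "('o, 'a, 'z) dagger_category_scheme \<Rightarrow> 'o \<Rightarrow> 'a set set" where
  "ClSub H X = {M \<in> Sub H X. \<exists>m\<in>M. dagger_mono H m}"

text \<open>In a pre-Hilbert category every closed subobject has a dagger mono representative, every
  arrow has a dagger mono kernel and a factorisation through a dagger mono image, all
  unique up to the equivalence of subobjects. The choices below are therefore harmless.\<close>

definition ClSub_rep :: "('o, 'a, 'z) dagger_category_scheme \<Rightarrow> 'a set \<Rightarrow> 'a" where
  "ClSub_rep H M = (SOME m. m \<in> M \<and> dagger_mono H m)"

definition Ker :: "('o, 'a, 'z) dagger_category_scheme \<Rightarrow> 'a \<Rightarrow> 'a" where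
  "Ker H f = (SOME k. kernel H k f \<and> dagger_mono H k)"

definition Im :: "('o, 'a, 'z) dagger_category_scheme \<Rightarrow> 'a \<Rightarrow> 'a set" where
  "Im H h = subobject_of H (SOME m. dagger_mono H m \<and>
    (\<exists>e. epi_arr H e \<and> e \<in> hom H (Dom H h) (Dom H m) \<and> Cod H m = Cod H h \<and> h = m \<cdot>\<^bsub>H\<^esub> e))"

definition direct_image :: "('o, 'a, 'z) dagger_category_scheme \<Rightarrow> 'a \<Rightarrow> 'a set \<Rightarrow> 'a set" where
  "direct_image H f M = Im H (f \<cdot>\<^bsub>H\<^esub> ClSub_rep H M)"

definition orthocomplement :: "('o, 'a, 'z) dagger_category_scheme \<Rightarrow> 'a set \<Rightarrow> 'a set" where
  "orthocomplement H M = subobject_of H (Ker H ((ClSub_rep H M)\<^sup>\<dagger>\<^bsub>H\<^esub>))"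

definition perp_map :: "('o, 'a, 'z) dagger_category_scheme \<Rightarrow> 'a \<Rightarrow> 'a set \<Rightarrow> 'a set" where
  "perp_map H f M = orthocomplement H (direct_image H f M)"

text \<open>The adjunction between the opposite of \<open>perp_map H f\<close>, as a map from \<open>ClSub H X\<close> to the
  opposite of \<open>ClSub H Y\<close>, and \<open>perp_map H g\<close>.\<close>

definition perp_adjoint ::
  "('o, 'a, 'z) dagger_category_scheme \<Rightarrow> 'o \<Rightarrow> 'o \<Rightarrow> 'a \<Rightarrow> 'a \<Rightarrow> bool" where
  "perp_adjoint H X Y f g \<longleftrightarrow> (\<forall>M\<in>ClSub H X. \<forall>N\<in>ClSub H Y.
    sub_le H N (perp_map H f M) \<longleftrightarrow> sub_le H M (perp_map H g N))"

section \<open>Symmetric dagger monoidal and pre-Hilbert categories\<close>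

record ('o, 'a) monoidal_dagger_category = "('o, 'a) dagger_category" +
  Tensor_Obj :: "'o \<Rightarrow> 'o \<Rightarrow> 'o"  (infixl "\<odot>\<index>" 75)
  Tensor :: "'a \<Rightarrow> 'a \<Rightarrow> 'a"  (infixl "\<otimes>\<index>" 75)
  Unit :: 'o
  Assoc :: "'o \<Rightarrow> 'o \<Rightarrow> 'o \<Rightarrow> 'a"
  LUnit :: "'o \<Rightarrow> 'a"
  RUnit :: "'o \<Rightarrow> 'a"
  Swap :: "'o \<Rightarrow> 'o \<Rightarrow> 'a"

locale symmetric_dagger_monoidal_category = dagger_category H
  for H :: "('o, 'a, 'z) monoidal_dagger_category_scheme" (structure) +
  assumes Tensor_Obj: "X \<in> Obj H \<Longrightarrow> Y \<in> Obj H \<Longrightarrow> X \<odot> Y \<in> Obj H"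
    and Tensor_hom: "f \<in> hom H X X' \<Longrightarrow> g \<in> hom H Y Y' \<Longrightarrow> f \<otimes> g \<in> hom H (X \<odot> Y) (X' \<odot> Y')"
    and Tensor_Id: "X \<in> Obj H \<Longrightarrow> Y \<in> Obj H \<Longrightarrow> Id H X \<otimes> Id H Y = Id H (X \<odot> Y)"
    and Tensor_Comp: "f \<in> hom H X X' \<Longrightarrow> f' \<in> hom H X' X'' \<Longrightarrow> g \<in> hom H Y Y' \<Longrightarrow> g' \<in> hom H Y' Y'' \<Longrightarrow>
      (f' \<cdot> f) \<otimes> (g' \<cdot> g) = (f' \<otimes> g') \<cdot> (f \<otimes> g)"
    and Unit_Obj: "Unit H \<in> Obj H"
    and Assoc_hom: "X \<in> Obj H \<Longrightarrow> Y \<in> Obj H \<Longrightarrow> Z \<in> Obj H \<Longrightarrow>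
      Assoc H X Y Z \<in> hom H ((X \<odot> Y) \<odot> Z) (X \<odot> (Y \<odot> Z))"
    and LUnit_hom: "X \<in> Obj H \<Longrightarrow> LUnit H X \<in> hom H (Unit H \<odot> X) X"
    and RUnit_hom: "X \<in> Obj H \<Longrightarrow> RUnit H X \<in> hom H (X \<odot> Unit H) X"
    and Swap_hom: "X \<in> Obj H \<Longrightarrow> Y \<in> Obj H \<Longrightarrow> Swap H X Y \<in> hom H (X \<odot> Y) (Y \<odot> X)"
    and Assoc_natural: "f \<in> hom H X X' \<Longrightarrow> g \<in> hom H Y Y' \<Longrightarrow> h \<in> hom H Z Z' \<Longrightarrow>
      Assoc H X' Y' Z' \<cdot> ((f \<otimes> g) \<otimes> h) = (f \<otimes> (g \<otimes> h)) \<cdot> Assoc H X Y Z"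
    and LUnit_natural: "f \<in> hom H X X' \<Longrightarrow> LUnit H X' \<cdot> (Id H (Unit H) \<otimes> f) = f \<cdot> LUnit H X"
    and RUnit_natural: "f \<in> hom H X X' \<Longrightarrow> RUnit H X' \<cdot> (f \<otimes> Id H (Unit H)) = f \<cdot> RUnit H X"
    and Swap_natural: "f \<in> hom H X X' \<Longrightarrow> g \<in> hom H Y Y' \<Longrightarrow>
      Swap H X' Y' \<cdot> (f \<otimes> g) = (g \<otimes> f) \<cdot> Swap H X Y"
    and pentagon: "W \<in> Obj H \<Longrightarrow> X \<in> Obj H \<Longrightarrow> Y \<in> Obj H \<Longrightarrow> Z \<in> Obj H \<Longrightarrow>
      Assoc H W X (Y \<odot> Z) \<cdot> Assoc H (W \<odot> X) Y Z =
      (Id H W \<otimes> Assoc H X Y Z) \<cdot> Assoc H W (X \<odot> Y) Z \<cdot> (Assoc H W X Y \<otimes> Id H Z)"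
    and triangle: "X \<in> Obj H \<Longrightarrow> Y \<in> Obj H \<Longrightarrow>
      (Id H X \<otimes> LUnit H Y) \<cdot> Assoc H X (Unit H) Y = RUnit H X \<otimes> Id H Y"
    and Swap_Swap: "X \<in> Obj H \<Longrightarrow> Y \<in> Obj H \<Longrightarrow> Swap H Y X \<cdot> Swap H X Y = Id H (X \<odot> Y)"
    and hexagon: "X \<in> Obj H \<Longrightarrow> Y \<in> Obj H \<Longrightarrow> Z \<in> Obj H \<Longrightarrow>
      Assoc H Y Z X \<cdot> Swap H X (Y \<odot> Z) \<cdot> Assoc H X Y Z =
      (Id H Y \<otimes> Swap H X Z) \<cdot> Assoc H Y X Z \<cdot> (Swap H X Y \<otimes> Id H Z)"
    and Dagger_Tensor: "f \<in> Arr H \<Longrightarrow> g \<in> Arr H \<Longrightarrow> (f \<otimes> g)\<^sup>\<dagger> = f\<^sup>\<dagger> \<otimes> g\<^sup>\<dagger>"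
    and Assoc_dagger_iso: "X \<in> Obj H \<Longrightarrow> Y \<in> Obj H \<Longrightarrow> Z \<in> Obj H \<Longrightarrow> dagger_iso H (Assoc H X Y Z)"
    and LUnit_dagger_iso: "X \<in> Obj H \<Longrightarrow> dagger_iso H (LUnit H X)"
    and RUnit_dagger_iso: "X \<in> Obj H \<Longrightarrow> dagger_iso H (RUnit H X)"
    and Swap_dagger_iso: "X \<in> Obj H \<Longrightarrow> Y \<in> Obj H \<Longrightarrow> dagger_iso H (Swap H X Y)"

text \<open>A zero object and binary dagger biproducts yield all finite dagger biproducts, and equalisers of
  parallel pairs those of finite nonempty families of parallel arrows.\<close>

locale pre_hilbert_category = symmetric_dagger_monoidal_category H
  for H :: "('o, 'a, 'z) monoidal_dagger_category_scheme" (structure) +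
  assumes zero_object_exists: "\<exists>Z. zero_object H Z"
    and dagger_biproduct_exists: "X \<in> Obj H \<Longrightarrow> Y \<in> Obj H \<Longrightarrow> \<exists>B p q. biproduct H X Y B p q (p\<^sup>\<dagger>) (q\<^sup>\<dagger>)"
    and dagger_equaliser_exists: "X \<in> Obj H \<Longrightarrow> Y \<in> Obj H \<Longrightarrow> f \<in> hom H X Y \<Longrightarrow> g \<in> hom H X Y \<Longrightarrow>
      \<exists>e. equaliser H e f g \<and> dagger_mono H e"
    and dagger_mono_kernel: "dagger_mono H m \<Longrightarrow> \<exists>f. kernel H m f"

definition scalar_mult :: "('o, 'a, 'z) monoidal_dagger_category_scheme \<Rightarrow> 'a \<Rightarrow> 'a \<Rightarrow> 'a"
    (infixr "\<bullet>\<index>" 75) where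
  "s \<bullet>\<^bsub>H\<^esub> h = LUnit H (Cod H h) \<cdot>\<^bsub>H\<^esub> (s \<otimes>\<^bsub>H\<^esub> h) \<cdot>\<^bsub>H\<^esub> inv_arr H (LUnit H (Dom H h))"

end

theory Submission
  imports Defs
begin

text \<open>The adjunction says that \<open>m\<^sup>\<dagger> \<cdot> f\<^sup>\<dagger> \<cdot> n\<close> vanishes exactly if \<open>m\<^sup>\<dagger> \<cdot> g \<cdot> n\<close> does, for all dagger monos \<open>m\<close>
  and \<open>n\<close>. Put \<open>F = f\<^sup>\<dagger>\<close> and \<open>G = g\<close>. As the unit is simple, a nonzero state \<open>F \<cdot> x\<close> spans the
  double orthocomplement of its image, so \<open>G \<cdot> x = F \<cdot> x \<cdot> t\<close> for a scalar \<open>t\<close>; as the unit is a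
  generator, it remains to see that \<open>t\<close> does not depend on \<open>x\<close>. Given two states, copair them to
  \<open>c\<close> on the biproduct of two units. If \<open>F \<cdot> c\<close> is mono, evaluate at the diagonal. Otherwise a
  projection of the biproduct is mono on the kernel of \<open>F \<cdot> c\<close>, and comparing two kernel elements
  gives the claim. No additive inverses of arrows are needed: since dagger monos are kernels, an
  arrow with zero kernel is mono.\<close>

section \<open>Composition and the order of subobjects in a category\<close>

declare hom_def [simp]

context category
begin

declare Dom_Obj [simp] Cod_Obj [simp]

lemma comp_simps [simp]:
  assumes "f \<in> Arr H" "g \<in> Arr H" "Dom H g = Cod H f"
  shows "g \<cdot> f \<in> Arr H" "Dom H (g \<cdot> f) = Dom H f" "Cod H (g \<cdot> f) = Cod H g"
  using Comp_hom[of f "Dom H f" "Cod H f" g "Cod H g"] assms by simp_all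

lemma id_simps [simp]:
  assumes "X \<in> Obj H"
  shows "Id H X \<in> Arr H" "Dom H (Id H X) = X" "Cod H (Id H X) = X"
  using Id_hom[OF assms] by simp_all

lemma comp_id [simp]: "f \<in> Arr H \<Longrightarrow> Dom H f = X \<Longrightarrow> f \<cdot> Id H X = f"
  using Comp_Id[of f] by simp

lemma id_comp [simp]: "f \<in> Arr H \<Longrightarrow> Cod H f = Y \<Longrightarrow> Id H Y \<cdot> f = f"
  using Id_Comp[of f] by simp

lemma comp_assoc [simp]:
  assumes "f \<in> Arr H" "g \<in> Arr H" "h \<in> Arr H" "Dom H g = Cod H f" "Dom H h = Cod H g"
  shows "(h \<cdot> g) \<cdot> f = h \<cdot> (g \<cdot> f)"
  using Comp_assoc[of f "Dom H f" "Cod H f" g "Cod H g" h "Cod H h"] assms by simp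

text \<open>The simplifier nests composites to the right, which hides \<open>h \<cdot> g\<close>
  inside \<open>h \<cdot> (g \<cdot> f)\<close>. In this form a known equation for
  \<open>h \<cdot> g\<close> can act there.\<close>

lemma comp_reassoc:
  assumes "h \<cdot> g = k" "f \<in> Arr H" "g \<in> Arr H" "h \<in> Arr H" "Dom H g = Cod H f" "Dom H h = Cod H g"
  shows "h \<cdot> (g \<cdot> f) = k \<cdot> f"
  using comp_assoc[of f g h] assms by simp

lemma inv_arr_eqI:
  assumes "inverse_arrs H f g"
  shows "inv_arr H f = g"
  unfolding inv_arr_def
proof (rule the_equality)
  show "inverse_arrs H f g" by fact
next
  fix g' assume g': "inverse_arrs H f g'"
  have "g' = g' \<cdot> (f \<cdot> g)" using assms g' by (simp add: inverse_arrs_def)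
  also have "\<dots> = (g' \<cdot> f) \<cdot> g" using assms g' by (intro comp_assoc[symmetric]) (auto simp: inverse_arrs_def)
  also have "\<dots> = g" using assms g' by (simp add: inverse_arrs_def del: comp_assoc)
  finally show "g' = g" .
qed

lemma iso_id: "X \<in> Obj H \<Longrightarrow> iso_arr H (Id H X)"
  unfolding iso_arr_def inverse_arrs_def by (intro exI[of _ "Id H X"]) simp

lemma same_subobject_refl: "m \<in> monos_into H X \<Longrightarrow> (m, m) \<in> same_subobject H X"
  by (auto simp: same_subobject_def monos_into_def mono_arr_def intro!: exI[of _ "Id H (Dom H m)"] iso_id)

lemma subobject_of_refl: "mono_arr H m \<Longrightarrow> m \<in> subobject_of H m"
  using same_subobject_refl[of m "Cod H m"] by (simp add: subobject_of_def monos_into_def)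

lemma subobject_of_memD:
  assumes "n \<in> subobject_of H m"
  obtains a b where "a \<in> hom H (Dom H m) (Dom H n)" "b \<in> hom H (Dom H n) (Dom H m)"
    "a \<cdot> b = Id H (Dom H n)" "b \<cdot> a = Id H (Dom H m)" "n \<cdot> a = m" "m \<cdot> b = n"
    "mono_arr H m" "mono_arr H n" "Cod H n = Cod H m"
proof -
  from assms obtain a b where ab: "inverse_arrs H a b" "a \<in> hom H (Dom H m) (Dom H n)" "m = n \<cdot> a"
    and mn: "mono_arr H m" "mono_arr H n" "Cod H n = Cod H m"
    by (auto simp: subobject_of_def same_subobject_def monos_into_def iso_arr_def)
  have arr: "n \<in> Arr H" "a \<in> Arr H" "b \<in> Arr H" "Cod H a = Dom H n" "Dom H b = Dom H n"
    "Cod H b = Dom H m" "Dom H a = Dom H m"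
    and inv: "a \<cdot> b = Id H (Dom H n)" "b \<cdot> a = Id H (Dom H m)"
    using ab(1,2) mn(2) by (simp_all add: inverse_arrs_def mono_arr_def)
  have "(n \<cdot> a) \<cdot> b = n" using arr inv by simp
  then have "m \<cdot> b = n" using ab(3) by (simp only:)
  with arr inv ab(3) mn show ?thesis by (intro that[of a b]) (auto simp only: hom_def)
qed

text \<open>\<open>sub_le\<close> asks only for some pair of representatives. The comparison
  isomorphisms carry a factorisation from that pair over to \<open>m\<close> and \<open>n\<close>,
  so the order can be tested on any chosen monos.\<close>

lemma sub_le_subobject_of:
  assumes "mono_arr H m" "mono_arr H n"
  shows "sub_le H (subobject_of H m) (subobject_of H n) \<longleftrightarrow> (\<exists>u\<in>hom H (Dom H m) (Dom H n). m = n \<cdot> u)"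
proof
  assume "\<exists>u\<in>hom H (Dom H m) (Dom H n). m = n \<cdot> u"
  with assms show "sub_le H (subobject_of H m) (subobject_of H n)"
    unfolding sub_le_def using subobject_of_refl by blast
next
  assume "sub_le H (subobject_of H m) (subobject_of H n)"
  then obtain m' n' u where m': "m' \<in> subobject_of H m" and n': "n' \<in> subobject_of H n"
    and u: "u \<in> hom H (Dom H m') (Dom H n')" "m' = n' \<cdot> u"
    unfolding sub_le_def by blast
  from m' obtain a where a: "a \<in> hom H (Dom H m) (Dom H m')" "m' \<cdot> a = m" "m' \<in> Arr H"
    by (rule subobject_of_memD) (simp add: mono_arr_def)
  from n' obtain b where b: "b \<in> hom H (Dom H n') (Dom H n)" "n \<cdot> b = n'" "n \<in> Arr H"
    by (rule subobject_of_memD) (simp add: mono_arr_def)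
  have "m = (n \<cdot> b) \<cdot> u \<cdot> a" by (simp only: b a u(2)[symmetric])
  also have "\<dots> = n \<cdot> (b \<cdot> (u \<cdot> a))" using a(1) u(1) b(1,3) by simp
  finally have "m = n \<cdot> (b \<cdot> (u \<cdot> a))" .
  moreover have "b \<cdot> (u \<cdot> a) \<in> hom H (Dom H m) (Dom H n)" using a(1) u(1) b(1) by simp
  ultimately show "\<exists>u\<in>hom H (Dom H m) (Dom H n). m = n \<cdot> u" by blast
qed

end

section \<open>Dagger monos and representatives of closed subobjects\<close>

context dagger_category
begin

lemma dagger_simps [simp]:
  assumes "f \<in> Arr H"
  shows "f\<^sup>\<dagger> \<in> Arr H" "Dom H (f\<^sup>\<dagger>) = Cod H f" "Cod H (f\<^sup>\<dagger>) = Dom H f" "(f\<^sup>\<dagger>)\<^sup>\<dagger> = f"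
  using Dagger_hom[of f] Dagger_Dagger[of f] assms by simp_all

declare Dagger_Id [simp]

lemma dagger_comp [simp]:
  "f \<in> Arr H \<Longrightarrow> g \<in> Arr H \<Longrightarrow> Dom H g = Cod H f \<Longrightarrow> (g \<cdot> f)\<^sup>\<dagger> = f\<^sup>\<dagger> \<cdot> g\<^sup>\<dagger>"
  using Dagger_Comp[of f "Dom H f" "Cod H f" g "Cod H g"] by simp

lemma dagger_mono_arr: "dagger_mono H m \<Longrightarrow> m \<in> Arr H"
  by (simp add: dagger_mono_def)

lemma dagger_mono_cancel:
  assumes "dagger_mono H m" "u \<in> Arr H" "Cod H u = Dom H m"
  shows "m\<^sup>\<dagger> \<cdot> (m \<cdot> u) = u"
proof -
  have "m\<^sup>\<dagger> \<cdot> m = Id H (Dom H m)" using assms by (simp add: dagger_mono_def)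
  from comp_reassoc[OF this] show ?thesis using assms by (simp add: dagger_mono_arr)
qed

lemma dagger_mono_mono: "dagger_mono H m \<Longrightarrow> mono_arr H m"
  unfolding mono_arr_def
proof (intro conjI ballI impI)
  fix W u v assume m: "dagger_mono H m" and uv: "u \<in> hom H W (Dom H m)" "v \<in> hom H W (Dom H m)"
    and eq: "m \<cdot> u = m \<cdot> v"
  from uv have "m\<^sup>\<dagger> \<cdot> (m \<cdot> u) = u" "m\<^sup>\<dagger> \<cdot> (m \<cdot> v) = v"
    using dagger_mono_cancel[OF m, of u] dagger_mono_cancel[OF m, of v] by simp_all
  then show "u = v" unfolding eq by (rule trans[OF sym])
qed (rule dagger_mono_arr)

lemma dagger_iso_inverse:
  assumes "dagger_iso H f"
  shows "inverse_arrs H f (f\<^sup>\<dagger>)"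
  using assms by (auto simp: dagger_iso_def dagger_mono_def dagger_epi_def inverse_arrs_def)

lemma mono_arr_cancel:
  assumes "mono_arr H m" "u \<in> hom H W (Dom H m)" "v \<in> hom H W (Dom H m)" "m \<cdot> u = m \<cdot> v"
  shows "u = v"
proof -
  have "W \<in> Obj H" using assms(2) by auto
  with assms show ?thesis unfolding mono_arr_def by blast
qed

lemma epi_arr_if_dagger_mono_arr:
  assumes "e \<in> Arr H" "mono_arr H (e\<^sup>\<dagger>)"
  shows "epi_arr H e"
  unfolding epi_arr_def
proof (intro conjI ballI impI)
  fix W u v assume W: "W \<in> Obj H" and u: "u \<in> hom H (Cod H e) W" and v: "v \<in> hom H (Cod H e) W"
    and eq: "u \<cdot> e = v \<cdot> e"
  have "e\<^sup>\<dagger> \<cdot> u\<^sup>\<dagger> = e\<^sup>\<dagger> \<cdot> v\<^sup>\<dagger>" using arg_cong[OF eq, of "Dagger H"] u v assms by simp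
  then have "u\<^sup>\<dagger> = v\<^sup>\<dagger>" using assms W u v unfolding mono_arr_def by auto
  then have "(u\<^sup>\<dagger>)\<^sup>\<dagger> = (v\<^sup>\<dagger>)\<^sup>\<dagger>" by simp
  with u v show "u = v" by simp
qed fact

lemma subobject_of_ClSub: "dagger_mono H m \<Longrightarrow> subobject_of H m \<in> ClSub H (Cod H m)"
  using dagger_mono_mono[of m] subobject_of_refl[of m]
  by (auto simp: ClSub_def Sub_def subobject_of_def monos_into_def intro!: quotientI)

lemma ClSub_rep_subobject_of:
  assumes "dagger_mono H m"
  shows "ClSub_rep H (subobject_of H m) \<in> subobject_of H m" "dagger_mono H (ClSub_rep H (subobject_of H m))"
proof -
  have "ClSub_rep H (subobject_of H m) \<in> subobject_of H m \<and> dagger_mono H (ClSub_rep H (subobject_of H m))"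
    unfolding ClSub_rep_def
    by (rule someI[of _ m]) (use assms dagger_mono_mono subobject_of_refl in blast)
  then show "ClSub_rep H (subobject_of H m) \<in> subobject_of H m" "dagger_mono H (ClSub_rep H (subobject_of H m))"
    by simp_all
qed

end

section \<open>Scalars and their action on arrows\<close>

context symmetric_dagger_monoidal_category
begin

declare Unit_Obj [simp] Tensor_Obj [simp]

lemma tensor_simps [simp]:
  assumes "f \<in> Arr H" "g \<in> Arr H"
  shows "f \<otimes> g \<in> Arr H" "Dom H (f \<otimes> g) = Dom H f \<odot> Dom H g" "Cod H (f \<otimes> g) = Cod H f \<odot> Cod H g"
  using Tensor_hom[of f "Dom H f" "Cod H f" g "Dom H g" "Cod H g"] assms by simp_all

lemma unitor_simps [simp]:
  assumes "X \<in> Obj H"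
  shows "LUnit H X \<in> Arr H" "Dom H (LUnit H X) = Unit H \<odot> X" "Cod H (LUnit H X) = X"
    "RUnit H X \<in> Arr H" "Dom H (RUnit H X) = X \<odot> Unit H" "Cod H (RUnit H X) = X"
    "LUnit H X \<cdot> (LUnit H X)\<^sup>\<dagger> = Id H X" "(LUnit H X)\<^sup>\<dagger> \<cdot> LUnit H X = Id H (Unit H \<odot> X)"
    "RUnit H X \<cdot> (RUnit H X)\<^sup>\<dagger> = Id H X" "(RUnit H X)\<^sup>\<dagger> \<cdot> RUnit H X = Id H (X \<odot> Unit H)"
  using LUnit_hom[OF assms] RUnit_hom[OF assms] LUnit_dagger_iso[OF assms] RUnit_dagger_iso[OF assms]
  by (simp_all add: dagger_iso_def dagger_mono_def dagger_epi_def)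

text \<open>The left unitor is a dagger isomorphism, so its inverse is its dagger, and
  \<open>inv_arr\<close> disappears from the calculations.\<close>

lemma scalar_mult_eq:
  assumes "h \<in> Arr H"
  shows "s \<bullet> h = LUnit H (Cod H h) \<cdot> (s \<otimes> h) \<cdot> (LUnit H (Dom H h))\<^sup>\<dagger>"
  using inv_arr_eqI[OF dagger_iso_inverse[OF LUnit_dagger_iso]] assms by (simp add: scalar_mult_def)

lemma scalar_mult_hom [simp]:
  assumes "h \<in> Arr H" "s \<in> hom H (Unit H) (Unit H)"
  shows "s \<bullet> h \<in> Arr H" "Dom H (s \<bullet> h) = Dom H h" "Cod H (s \<bullet> h) = Cod H h"
  using assms by (simp_all add: scalar_mult_eq)

lemma LUnit_dagger_natural:
  assumes "f \<in> Arr H"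
  shows "(LUnit H (Cod H f))\<^sup>\<dagger> \<cdot> f = (Id H (Unit H) \<otimes> f) \<cdot> (LUnit H (Dom H f))\<^sup>\<dagger>"
proof -
  have "LUnit H (Dom H f) \<cdot> (Id H (Unit H) \<otimes> f\<^sup>\<dagger>) = f\<^sup>\<dagger> \<cdot> LUnit H (Cod H f)"
    using LUnit_natural[of "f\<^sup>\<dagger>" "Cod H f" "Dom H f"] assms by simp
  from arg_cong[OF this, of "Dagger H"] show ?thesis
    using assms by (simp add: Dagger_Tensor)
qed

text \<open>Naturality of the left unitor moves the state \<open>x\<close> into the tensor product,
  the interchange law separates \<open>s\<close> from \<open>h \<cdot> x\<close>, and naturality
  moves \<open>h \<cdot> x\<close> out again. On states the tensor thus reduces to precomposition
  with an endomorphism of the unit.\<close>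

lemma scalar_mult_comp:
  assumes "h \<in> Arr H" "s \<in> hom H (Unit H) (Unit H)" "x \<in> hom H (Unit H) (Dom H h)"
  shows "(s \<bullet> h) \<cdot> x = h \<cdot> x \<cdot> (s \<bullet> Id H (Unit H))"
proof -
  let ?C = "Unit H"
  have "(s \<bullet> h) \<cdot> x = LUnit H (Cod H h) \<cdot> ((s \<otimes> h) \<cdot> ((LUnit H (Cod H x))\<^sup>\<dagger> \<cdot> x))"
    using assms by (simp add: scalar_mult_eq)
  also have "\<dots> = LUnit H (Cod H h) \<cdot> (((s \<otimes> h) \<cdot> (Id H ?C \<otimes> x)) \<cdot> (LUnit H ?C)\<^sup>\<dagger>)"
    using assms LUnit_dagger_natural[of x] by simp
  \<comment> \<open>By interchange both composites equal
    \<open>s \<otimes> (h \<cdot> x)\<close>.\<close>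
  also have "(s \<otimes> h) \<cdot> (Id H ?C \<otimes> x) = (Id H ?C \<otimes> (h \<cdot> x)) \<cdot> (s \<otimes> Id H ?C)"
    using assms Tensor_Comp[of "Id H ?C" ?C ?C s ?C x ?C "Dom H h" h "Cod H h"]
      Tensor_Comp[of s ?C ?C "Id H ?C" ?C "Id H ?C" ?C ?C "h \<cdot> x" "Cod H h"] by simp
  also have "LUnit H (Cod H h) \<cdot> ((Id H ?C \<otimes> (h \<cdot> x)) \<cdot> (s \<otimes> Id H ?C) \<cdot> (LUnit H ?C)\<^sup>\<dagger>)
      = (LUnit H (Cod H h) \<cdot> (Id H ?C \<otimes> (h \<cdot> x))) \<cdot> ((s \<otimes> Id H ?C) \<cdot> (LUnit H ?C)\<^sup>\<dagger>)"
    using assms by simp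
  also have "LUnit H (Cod H h) \<cdot> (Id H ?C \<otimes> (h \<cdot> x)) = (h \<cdot> x) \<cdot> LUnit H ?C"
    using LUnit_natural[of "h \<cdot> x" ?C "Cod H h"] assms by simp
  also have "\<dots> \<cdot> ((s \<otimes> Id H ?C) \<cdot> (LUnit H ?C)\<^sup>\<dagger>) = h \<cdot> x \<cdot> (s \<bullet> Id H ?C)"
    using assms by (simp add: scalar_mult_eq)
  finally show ?thesis .
qed

text \<open>Conjugating by \<open>r\<close> avoids the coherence law that both unitors agree at the unit.\<close>

lemma scalar_mult_id_RUnit:
  assumes "s \<in> hom H (Unit H) (Unit H)"
  defines "r \<equiv> RUnit H (Unit H) \<cdot> (LUnit H (Unit H))\<^sup>\<dagger>"
  shows "s \<bullet> Id H (Unit H) = r\<^sup>\<dagger> \<cdot> (s \<cdot> r)"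
proof -
  let ?C = "Unit H"
  have "s \<otimes> Id H ?C = ((RUnit H ?C)\<^sup>\<dagger> \<cdot> RUnit H ?C) \<cdot> (s \<otimes> Id H ?C)"
    using assms(1) by simp
  also have "\<dots> = (RUnit H ?C)\<^sup>\<dagger> \<cdot> (RUnit H ?C \<cdot> (s \<otimes> Id H ?C))"
    using assms(1) by (intro comp_assoc) simp_all
  also have "RUnit H ?C \<cdot> (s \<otimes> Id H ?C) = s \<cdot> RUnit H ?C"
    using RUnit_natural[OF assms(1)] .
  finally show ?thesis using assms(1) by (simp add: scalar_mult_eq r_def)
qed

lemma LUnit_RUnit_unitary:
  defines "r \<equiv> RUnit H (Unit H) \<cdot> (LUnit H (Unit H))\<^sup>\<dagger>"
  shows "r \<in> hom H (Unit H) (Unit H)" "r\<^sup>\<dagger> \<cdot> r = Id H (Unit H)" "r \<cdot> r\<^sup>\<dagger> = Id H (Unit H)"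
  by (simp_all add: r_def comp_reassoc[OF unitor_simps(8)] comp_reassoc[OF unitor_simps(10)])

text \<open>\<open>s \<bullet> Id H (Unit H)\<close> is \<open>s\<close> conjugated by the unitary
  \<open>r\<close>, and such a conjugation is invertible; the witness is \<open>t\<close> conjugated
  the other way.\<close>

lemma ex_scalar_mult_id:
  assumes "t \<in> hom H (Unit H) (Unit H)"
  shows "\<exists>s\<in>hom H (Unit H) (Unit H). s \<bullet> Id H (Unit H) = t"
proof -
  let ?C = "Unit H"
  define r where "r = RUnit H ?C \<cdot> (LUnit H ?C)\<^sup>\<dagger>"
  note r = LUnit_RUnit_unitary[folded r_def]
  have "(r \<cdot> (t \<cdot> r\<^sup>\<dagger>)) \<bullet> Id H ?C = r\<^sup>\<dagger> \<cdot> ((r \<cdot> (t \<cdot> r\<^sup>\<dagger>)) \<cdot> r)"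
    using scalar_mult_id_RUnit[of "r \<cdot> (t \<cdot> r\<^sup>\<dagger>)", folded r_def] r(1) assms by simp
  also have "\<dots> = t" using r(1) assms by (simp add: r(2) comp_reassoc[OF r(2)])
  finally show ?thesis using r(1) assms by (intro bexI[of _ "r \<cdot> (t \<cdot> r\<^sup>\<dagger>)"]) simp_all
qed

lemma scalar_mult_id_inject:
  assumes "s \<in> hom H (Unit H) (Unit H)" "t \<in> hom H (Unit H) (Unit H)"
    and eq: "s \<bullet> Id H (Unit H) = t \<bullet> Id H (Unit H)"
  shows "s = t"
proof -
  let ?C = "Unit H"
  define r where "r = RUnit H ?C \<cdot> (LUnit H ?C)\<^sup>\<dagger>"
  note r = LUnit_RUnit_unitary[folded r_def]
  have *: "r \<cdot> ((u \<bullet> Id H ?C) \<cdot> r\<^sup>\<dagger>) = u" if "u \<in> hom H ?C ?C" for u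
    using scalar_mult_id_RUnit[OF that, folded r_def] r(1) that
    by (simp add: r(3) comp_reassoc[OF r(3)])
  show ?thesis using *[OF assms(1)] *[OF assms(2)] unfolding eq by (rule trans[OF sym])
qed

text \<open>Every scalar has the form \<open>r \<bullet> Id H (Unit H)\<close>, and
  \<open>scalar_mult_comp\<close>, with the identity as \<open>h\<close> and the scalar
  \<open>t\<close> as the state, lets these commute with \<open>t\<close>.\<close>

lemma scalar_commute:
  assumes "s \<in> hom H (Unit H) (Unit H)" "t \<in> hom H (Unit H) (Unit H)"
  shows "s \<cdot> t = t \<cdot> s"
proof -
  obtain r where r: "r \<in> hom H (Unit H) (Unit H)" "r \<bullet> Id H (Unit H) = s"
    using ex_scalar_mult_id[OF assms(1)] by blast
  show ?thesis using scalar_mult_comp[of "Id H (Unit H)" r t] r assms by simp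
qed

end

section \<open>Zero arrows, kernels and images\<close>

context pre_hilbert_category
begin

lemma zero_objectD:
  assumes "zero_object H Z" "X \<in> Obj H"
  shows "\<exists>u. u \<in> hom H X Z" "\<exists>v. v \<in> hom H Z X"
    "u \<in> hom H X Z \<Longrightarrow> u' \<in> hom H X Z \<Longrightarrow> u = u'"
    "v \<in> hom H Z X \<Longrightarrow> v' \<in> hom H Z X \<Longrightarrow> v = v'"
  using assms unfolding zero_object_def by blast+

text \<open>\<open>zero_arr\<close> is a definite description over all zero objects at once.
  Composites through two of them agree since the comparison arrow \<open>w\<close> is compatible
  with both legs by uniqueness.\<close>

lemma zero_arr_eq:
  assumes "zero_object H Z" "u \<in> hom H X Z" "v \<in> hom H Z Y"
  shows "zero_arr H X Y = v \<cdot> u"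
  unfolding zero_arr_def
proof (rule the_equality)
  show "\<exists>Z u' v'. zero_object H Z \<and> u' \<in> hom H X Z \<and> v' \<in> hom H Z Y \<and> v \<cdot> u = v' \<cdot> u'"
    using assms by blast
next
  fix f assume "\<exists>Z u v. zero_object H Z \<and> u \<in> hom H X Z \<and> v \<in> hom H Z Y \<and> f = v \<cdot> u"
  then obtain Z' u' v' where Z': "zero_object H Z'" "u' \<in> hom H X Z'" "v' \<in> hom H Z' Y" "f = v' \<cdot> u'"
    by blast
  have obj: "X \<in> Obj H" "Y \<in> Obj H" "Z \<in> Obj H" using assms by auto
  then obtain w where w: "w \<in> hom H Z Z'" using zero_objectD(1)[OF Z'(1)] by blast
  have "w \<cdot> u = u'" using zero_objectD(3)[OF Z'(1) obj(1) Comp_hom[OF assms(2) w] Z'(2)] .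
  moreover have "v' \<cdot> w = v" using zero_objectD(4)[OF assms(1) obj(2) Comp_hom[OF w Z'(3)] assms(3)] .
  ultimately show "f = v \<cdot> u"
    using Comp_assoc[OF assms(2) w Z'(3)] Z'(4) by simp
qed

lemma zero_arr_factor:
  assumes "X \<in> Obj H" "Y \<in> Obj H"
  obtains Z u v where "zero_object H Z" "u \<in> hom H X Z" "v \<in> hom H Z Y" "zero_arr H X Y = v \<cdot> u"
proof -
  obtain Z where Z: "zero_object H Z" using zero_object_exists by blast
  obtain u v where "u \<in> hom H X Z" "v \<in> hom H Z Y"
    using assms zero_objectD(1,2)[OF Z] by blast
  with Z that zero_arr_eq show ?thesis by blast
qed

lemma zero_arr_simps [simp]:
  assumes "X \<in> Obj H" "Y \<in> Obj H"
  shows "zero_arr H X Y \<in> Arr H" "Dom H (zero_arr H X Y) = X" "Cod H (zero_arr H X Y) = Y"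
proof -
  obtain Z u v where "u \<in> hom H X Z" "v \<in> hom H Z Y" "zero_arr H X Y = v \<cdot> u"
    using zero_arr_factor[OF assms] .
  then show "zero_arr H X Y \<in> Arr H" "Dom H (zero_arr H X Y) = X" "Cod H (zero_arr H X Y) = Y"
    by simp_all
qed

lemma comp_zero_arr [simp]:
  assumes "X \<in> Obj H" "f \<in> Arr H" "Dom H f = Y"
  shows "f \<cdot> zero_arr H X Y = zero_arr H X (Cod H f)"
proof -
  have "Y \<in> Obj H" using assms by auto
  then obtain Z u v where *: "zero_object H Z" "u \<in> hom H X Z" "v \<in> hom H Z Y" "zero_arr H X Y = v \<cdot> u"
    using assms(1) zero_arr_factor by blast
  show ?thesis using zero_arr_eq[OF *(1,2), of "f \<cdot> v" "Cod H f"] * assms by simp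
qed

lemma zero_arr_comp [simp]:
  assumes "Z \<in> Obj H" "f \<in> Arr H" "Cod H f = Y"
  shows "zero_arr H Y Z \<cdot> f = zero_arr H (Dom H f) Z"
proof -
  have "Y \<in> Obj H" using assms by auto
  then obtain A u v where *: "zero_object H A" "u \<in> hom H Y A" "v \<in> hom H A Z" "zero_arr H Y Z = v \<cdot> u"
    using assms(1) zero_arr_factor by blast
  show ?thesis using zero_arr_eq[OF *(1), of "u \<cdot> f" "Dom H f" v Z] * assms by simp
qed

lemma dagger_zero_arr [simp]:
  assumes "X \<in> Obj H" "Y \<in> Obj H"
  shows "(zero_arr H X Y)\<^sup>\<dagger> = zero_arr H Y X"
proof -
  obtain Z u v where *: "zero_object H Z" "u \<in> hom H X Z" "v \<in> hom H Z Y" "zero_arr H X Y = v \<cdot> u"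
    using zero_arr_factor[OF assms] .
  show ?thesis using zero_arr_eq[OF *(1), of "v\<^sup>\<dagger>" Y "u\<^sup>\<dagger>" X] * by simp
qed

lemma dagger_eq_zero_arr:
  assumes "f \<in> Arr H" "f\<^sup>\<dagger> = zero_arr H (Cod H f) (Dom H f)"
  shows "f = zero_arr H (Dom H f) (Cod H f)"
  using arg_cong[OF assms(2), of "Dagger H"] assms(1) by simp

lemma kernelD:
  assumes "kernel H k f"
  shows "k \<in> Arr H" "f \<in> Arr H" "Dom H f = Cod H k" "f \<cdot> k = zero_arr H (Dom H k) (Cod H f)"
    "w \<in> Arr H \<Longrightarrow> Cod H w = Dom H f \<Longrightarrow> f \<cdot> w = zero_arr H (Dom H w) (Cod H f) \<Longrightarrow>
      \<exists>u\<in>hom H (Dom H w) (Dom H k). w = k \<cdot> u"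
proof -
  show k: "k \<in> Arr H" "f \<in> Arr H" "Dom H f = Cod H k"
    using assms by (simp_all add: kernel_def equaliser_def)
  have eq: "f \<cdot> k = zero_arr H (Dom H f) (Cod H f) \<cdot> k"
    and univ: "\<And>W h. W \<in> Obj H \<Longrightarrow> h \<in> hom H W (Cod H k) \<Longrightarrow>
      f \<cdot> h = zero_arr H (Dom H f) (Cod H f) \<cdot> h \<Longrightarrow> \<exists>u\<in>hom H W (Dom H k). k \<cdot> u = h"
    using assms unfolding kernel_def equaliser_def by blast+
  show "f \<cdot> k = zero_arr H (Dom H k) (Cod H f)" using k eq by simp
  assume w: "w \<in> Arr H" "Cod H w = Dom H f" "f \<cdot> w = zero_arr H (Dom H w) (Cod H f)"
  then have "\<exists>u\<in>hom H (Dom H w) (Dom H k). k \<cdot> u = w"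
    using k by (intro univ) simp_all
  then show "\<exists>u\<in>hom H (Dom H w) (Dom H k). w = k \<cdot> u" by blast
qed

lemma ex_dagger_kernel:
  assumes "f \<in> Arr H"
  shows "\<exists>k. kernel H k f \<and> dagger_mono H k"
  unfolding kernel_def using assms by (intro dagger_equaliser_exists) simp_all

text \<open>Stands in for the subtraction that would turn \<open>f \<cdot> u = f \<cdot> v\<close>
  into a vanishing composite. The dagger equaliser \<open>q\<close> of
  \<open>u\<^sup>\<dagger>\<close> and \<open>v\<^sup>\<dagger>\<close> is a kernel of some
  \<open>k\<close>, and this turns the factorisation of \<open>f\<^sup>\<dagger>\<close> through
  \<open>q\<close> into a vanishing statement.\<close>

lemma mono_arr_if_zero_kernel:
  assumes f: "f \<in> Arr H"
    and ker: "\<And>w. w \<in> Arr H \<Longrightarrow> Cod H w = Dom H f \<Longrightarrow> f \<cdot> w = zero_arr H (Dom H w) (Cod H f) \<Longrightarrow>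
      w = zero_arr H (Dom H w) (Dom H f)"
  shows "mono_arr H f"
  unfolding mono_arr_def
proof (intro conjI ballI impI)
  fix W u v
  assume W: "W \<in> Obj H" and u: "u \<in> hom H W (Dom H f)" and v: "v \<in> hom H W (Dom H f)"
    and eq: "f \<cdot> u = f \<cdot> v"
  obtain q where q: "equaliser H q (u\<^sup>\<dagger>) (v\<^sup>\<dagger>)" "dagger_mono H q"
    using dagger_equaliser_exists[of "Dom H f" W "u\<^sup>\<dagger>" "v\<^sup>\<dagger>"] u v f W by auto
  have q': "q \<in> Arr H" "Cod H q = Dom H f" "u\<^sup>\<dagger> \<cdot> q = v\<^sup>\<dagger> \<cdot> q"
    using q(1) u unfolding equaliser_def by simp_all
  have "u\<^sup>\<dagger> \<cdot> f\<^sup>\<dagger> = v\<^sup>\<dagger> \<cdot> f\<^sup>\<dagger>" using arg_cong[OF eq, of "Dagger H"] u v f by simp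
  moreover have "Cod H f \<in> Obj H" "f\<^sup>\<dagger> \<in> hom H (Cod H f) (Cod H q)" using f q' by simp_all
  ultimately obtain r where r: "r \<in> hom H (Cod H f) (Dom H q)" "q \<cdot> r = f\<^sup>\<dagger>"
    using q(1) unfolding equaliser_def by blast
  obtain k where k: "kernel H q k" using dagger_mono_kernel[OF q(2)] by blast
  note kD = kernelD[OF k]
  \<comment> \<open>\<open>k\<close> kills its kernel \<open>q\<close> and hence
    \<open>f\<^sup>\<dagger>\<close>. After taking daggers, \<open>f\<close> kills
    \<open>k\<^sup>\<dagger>\<close>, which \<open>ker\<close> forces to vanish.\<close>
  have "k \<cdot> f\<^sup>\<dagger> = zero_arr H (Cod H f) (Cod H k)"
    using kD(1-3) r by (simp add: r(2)[symmetric] comp_reassoc[OF kD(4)])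
  from arg_cong[OF this, of "Dagger H"] have "f \<cdot> k\<^sup>\<dagger> = zero_arr H (Cod H k) (Cod H f)"
    using kD(1-3) q' f by simp
  then have "k\<^sup>\<dagger> = zero_arr H (Cod H k) (Dom H k)"
    using ker[of "k\<^sup>\<dagger>"] kD(1-3) q' by simp
  then have "k = zero_arr H (Dom H k) (Cod H k)" using kD(2) dagger_eq_zero_arr by blast
  moreover have "zero_arr H (Dom H k) (Cod H k) \<cdot> Id H (Dom H k) = zero_arr H (Dom H k) (Cod H k)"
    using kD(2) by simp
  \<comment> \<open>Since \<open>k\<close> is zero, the identity factors through its kernel
    \<open>q\<close>. So \<open>q\<close> has a section, and arrows that agree on \<open>q\<close>
    are equal.\<close>
  ultimately obtain w where w: "w \<in> hom H (Dom H k) (Dom H q)" "q \<cdot> w = Id H (Dom H k)"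
    using kD(5)[of "Id H (Dom H k)"] kD(2) by auto
  have "u\<^sup>\<dagger> \<cdot> (q \<cdot> w) = v\<^sup>\<dagger> \<cdot> (q \<cdot> w)"
    using q' w(1) u v by (simp add: comp_reassoc[OF q'(3)])
  then have "u\<^sup>\<dagger> = v\<^sup>\<dagger>" using w(2) u v kD(3) q'(2) by simp
  from arg_cong[OF this, of "Dagger H"] show "u = v" using u v by simp
qed fact

text \<open>The double orthocomplement \<open>i\<close> serves as the image. If
  \<open>e\<^sup>\<dagger>\<close> kills \<open>w\<close>, then \<open>f\<^sup>\<dagger>\<close>
  kills \<open>i \<cdot> w\<close>, which therefore lies in \<open>j\<close> as well as in the
  kernel of \<open>j\<^sup>\<dagger>\<close> and must vanish. Monicity is stated for
  \<open>e\<^sup>\<dagger>\<close> since it serves twice: it makes \<open>e\<close> epi, and for a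
  state \<open>f\<close> it gives a mono into the unit.\<close>

lemma image_factorisation:
  assumes f: "f \<in> Arr H" and j: "kernel H j (f\<^sup>\<dagger>)" "dagger_mono H j"
  shows "\<exists>i e. kernel H i (j\<^sup>\<dagger>) \<and> dagger_mono H i \<and> mono_arr H (e\<^sup>\<dagger>) \<and>
    e \<in> hom H (Dom H f) (Dom H i) \<and> Cod H i = Cod H f \<and> f = i \<cdot> e"
proof -
  note jD = kernelD[OF j(1)]
  obtain i where i: "kernel H i (j\<^sup>\<dagger>)" "dagger_mono H i" using ex_dagger_kernel[of "j\<^sup>\<dagger>"] jD by auto
  note iD = kernelD[OF i(1)]
  have "j\<^sup>\<dagger> \<cdot> f = zero_arr H (Dom H f) (Dom H j)"
    using arg_cong[OF jD(4), of "Dagger H"] jD(1,3) f by simp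
  then obtain e where e: "e \<in> hom H (Dom H f) (Dom H i)" "f = i \<cdot> e"
    using iD(5)[of f] jD(1,3) f by auto
  have C: "Cod H i = Cod H f" "Cod H j = Cod H f" using iD(3) jD(1,3) f by simp_all
  have "mono_arr H (e\<^sup>\<dagger>)"
  proof (rule mono_arr_if_zero_kernel)
    fix w assume w: "w \<in> Arr H" "Cod H w = Dom H (e\<^sup>\<dagger>)" "e\<^sup>\<dagger> \<cdot> w = zero_arr H (Dom H w) (Cod H (e\<^sup>\<dagger>))"
    have wi: "Cod H w = Dom H i" using w e by simp
    have "f\<^sup>\<dagger> \<cdot> (i \<cdot> w) = e\<^sup>\<dagger> \<cdot> (i\<^sup>\<dagger> \<cdot> (i \<cdot> w))"
      using e(1) iD(1) w(1) wi unfolding e(2) by simp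
    also have "i\<^sup>\<dagger> \<cdot> (i \<cdot> w) = w" using i(2) w(1) wi by (rule dagger_mono_cancel)
    finally have "f\<^sup>\<dagger> \<cdot> (i \<cdot> w) = zero_arr H (Dom H w) (Dom H f)" using w(3) e(1) by simp
    then obtain u where u: "u \<in> hom H (Dom H w) (Dom H j)" "i \<cdot> w = j \<cdot> u"
      using jD(5)[of "i \<cdot> w"] w(1) wi f iD(1) C by auto
    have "u = j\<^sup>\<dagger> \<cdot> (i \<cdot> w)" using dagger_mono_cancel[OF j(2), of u] u by simp
    also have "\<dots> = zero_arr H (Dom H w) (Dom H j)"
      using comp_reassoc[OF iD(4), of w] iD(1-3) w(1) wi jD(1) by simp
    finally have "i \<cdot> w = zero_arr H (Dom H w) (Cod H i)" using u jD(1) C w(1) by simp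
    then have "i\<^sup>\<dagger> \<cdot> (i \<cdot> w) = zero_arr H (Dom H w) (Dom H i)" using iD(1) w(1) by simp
    with \<open>i\<^sup>\<dagger> \<cdot> (i \<cdot> w) = w\<close> wi w(2) show "w = zero_arr H (Dom H w) (Dom H (e\<^sup>\<dagger>))" by simp
  qed (use e in simp)
  with i e C show ?thesis by blast
qed

lemma mono_arr_zero_cancel:
  assumes "mono_arr H m" "u \<in> hom H W (Dom H m)" "m \<cdot> u = zero_arr H W (Cod H m)"
  shows "u = zero_arr H W (Dom H m)"
proof -
  have "W \<in> Obj H" "m \<in> Arr H" using assms by (auto simp: mono_arr_def)
  then show ?thesis using assms(3)
    by (intro mono_arr_cancel[OF assms(1,2), of "zero_arr H W (Dom H m)"]) (simp_all add: mono_arr_def)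
qed

text \<open>Justifies the choice made in \<open>Im\<close>.\<close>

lemma ex_epi_dagger_mono_factorisation:
  assumes "h \<in> Arr H"
  shows "\<exists>m. dagger_mono H m \<and> (\<exists>e. epi_arr H e \<and> e \<in> hom H (Dom H h) (Dom H m) \<and> Cod H m = Cod H h \<and> h = m \<cdot> e)"
proof -
  obtain j where "kernel H j (h\<^sup>\<dagger>)" "dagger_mono H j"
    using ex_dagger_kernel[of "h\<^sup>\<dagger>"] assms by auto
  from image_factorisation[OF assms this] obtain i e where i: "dagger_mono H i" "mono_arr H (e\<^sup>\<dagger>)"
    "e \<in> hom H (Dom H h) (Dom H i)" "Cod H i = Cod H h" "h = i \<cdot> e" by blast
  moreover have "epi_arr H e" using i(2,3) by (intro epi_arr_if_dagger_mono_arr) simp_all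
  ultimately show ?thesis by blast
qed

section \<open>Orthogonality and the adjunction as vanishing of composites\<close>

lemma sub_le_orthocomplement:
  assumes m: "dagger_mono H m" and n: "dagger_mono H n" and C: "Cod H n = Cod H m"
  shows "sub_le H (subobject_of H n) (orthocomplement H (subobject_of H m)) \<longleftrightarrow>
    m\<^sup>\<dagger> \<cdot> n = zero_arr H (Dom H n) (Dom H m)"
proof -
  define r where "r = ClSub_rep H (subobject_of H m)"
  have r: "r \<in> subobject_of H m" "dagger_mono H r" unfolding r_def using ClSub_rep_subobject_of[OF m] .
  from r(1) obtain a b where a: "a \<in> hom H (Dom H m) (Dom H r)" "r \<cdot> a = m"
    and b: "b \<in> hom H (Dom H r) (Dom H m)" "m \<cdot> b = r" and Cr: "Cod H r = Cod H m"
    by (rule subobject_of_memD)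
  note arr = dagger_mono_arr[OF m] dagger_mono_arr[OF n] dagger_mono_arr[OF r(2)]
  define k where "k = Ker H (r\<^sup>\<dagger>)"
  have k: "kernel H k (r\<^sup>\<dagger>)" "dagger_mono H k"
    using someI_ex[OF ex_dagger_kernel[of "r\<^sup>\<dagger>"]] arr unfolding k_def Ker_def by simp_all
  note kD = kernelD[OF k(1)]
  have "orthocomplement H (subobject_of H m) = subobject_of H k"
    by (simp add: orthocomplement_def k_def r_def)
  then have "sub_le H (subobject_of H n) (orthocomplement H (subobject_of H m)) \<longleftrightarrow>
      (\<exists>u\<in>hom H (Dom H n) (Dom H k). n = k \<cdot> u)"
    using sub_le_subobject_of[OF dagger_mono_mono[OF n] dagger_mono_mono[OF k(2)]] by simp
  also have "\<dots> \<longleftrightarrow> r\<^sup>\<dagger> \<cdot> n = zero_arr H (Dom H n) (Dom H r)"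
  proof
    assume "\<exists>u\<in>hom H (Dom H n) (Dom H k). n = k \<cdot> u"
    then obtain u where u: "u \<in> hom H (Dom H n) (Dom H k)" "n = k \<cdot> u" by blast
    have "r\<^sup>\<dagger> \<cdot> (k \<cdot> u) = zero_arr H (Dom H k) (Dom H r) \<cdot> u"
      using comp_reassoc[OF kD(4), of u] kD(1-3) u(1) arr(3) by simp
    also have "\<dots> = zero_arr H (Dom H n) (Dom H r)" using u(1) kD(1) arr(3) by simp
    finally show "r\<^sup>\<dagger> \<cdot> n = zero_arr H (Dom H n) (Dom H r)" using u(2) by (simp only:)
  next
    assume "r\<^sup>\<dagger> \<cdot> n = zero_arr H (Dom H n) (Dom H r)"
    then show "\<exists>u\<in>hom H (Dom H n) (Dom H k). n = k \<cdot> u"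
      using kD(5)[of n] arr C Cr by simp
  qed
  \<comment> \<open>The chosen representative \<open>r\<close> and \<open>m\<close> factor through
    each other, so their daggers kill the same arrows.\<close>
  also have "\<dots> \<longleftrightarrow> m\<^sup>\<dagger> \<cdot> n = zero_arr H (Dom H n) (Dom H m)"
  proof
    assume *: "r\<^sup>\<dagger> \<cdot> n = zero_arr H (Dom H n) (Dom H r)"
    have "m\<^sup>\<dagger> \<cdot> n = a\<^sup>\<dagger> \<cdot> (r\<^sup>\<dagger> \<cdot> n)" unfolding a(2)[symmetric] using a(1) arr C Cr by simp
    with * show "m\<^sup>\<dagger> \<cdot> n = zero_arr H (Dom H n) (Dom H m)" using a(1) arr by simp
  next
    assume *: "m\<^sup>\<dagger> \<cdot> n = zero_arr H (Dom H n) (Dom H m)"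
    have "r\<^sup>\<dagger> \<cdot> n = b\<^sup>\<dagger> \<cdot> (m\<^sup>\<dagger> \<cdot> n)" unfolding b(2)[symmetric] using b(1) arr C by simp
    with * show "r\<^sup>\<dagger> \<cdot> n = zero_arr H (Dom H n) (Dom H r)" using b(1) arr by simp
  qed
  finally show ?thesis .
qed

text \<open>Up to the isomorphism between \<open>m\<close> and the representative \<open>r\<close>,
  the arrow \<open>f \<cdot> m\<close> is the image \<open>i\<close> precomposed with the epi
  \<open>e\<close>. Precomposing with an epi or an isomorphism does not affect whether an arrow
  vanishes, so all choices drop out.\<close>

lemma sub_le_perp_map:
  assumes f: "f \<in> hom H X Y" and m: "dagger_mono H m" "Cod H m = X" and n: "dagger_mono H n" "Cod H n = Y"
  shows "sub_le H (subobject_of H n) (perp_map H f (subobject_of H m)) \<longleftrightarrow>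
    n\<^sup>\<dagger> \<cdot> (f \<cdot> m) = zero_arr H (Dom H m) (Dom H n)"
proof -
  define r where "r = ClSub_rep H (subobject_of H m)"
  have r: "r \<in> subobject_of H m" "dagger_mono H r" unfolding r_def using ClSub_rep_subobject_of[OF m(1)] .
  from r(1) obtain a b where a: "a \<in> hom H (Dom H m) (Dom H r)" "r \<cdot> a = m"
    and b: "b \<in> hom H (Dom H r) (Dom H m)" "m \<cdot> b = r" and Cr: "Cod H r = Cod H m"
    by (rule subobject_of_memD)
  note arr = dagger_mono_arr[OF m(1)] dagger_mono_arr[OF n(1)] dagger_mono_arr[OF r(2)]
  have fr: "f \<cdot> r \<in> Arr H" "Dom H (f \<cdot> r) = Dom H r" "Cod H (f \<cdot> r) = Y" using f arr Cr m(2) by simp_all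
  define i where "i = (SOME i. dagger_mono H i \<and> (\<exists>e. epi_arr H e \<and>
    e \<in> hom H (Dom H (f \<cdot> r)) (Dom H i) \<and> Cod H i = Cod H (f \<cdot> r) \<and> f \<cdot> r = i \<cdot> e))"
  from someI_ex[OF ex_epi_dagger_mono_factorisation[OF fr(1)]]
  obtain e where i: "dagger_mono H i" "Cod H i = Y"
    and e: "epi_arr H e" "e \<in> hom H (Dom H r) (Dom H i)" "f \<cdot> r = i \<cdot> e"
    unfolding i_def[symmetric] unfolding fr by blast
  note arr = arr dagger_mono_arr[OF i(1)]
  have "direct_image H f (subobject_of H m) = subobject_of H i"
    by (simp add: direct_image_def Im_def i_def r_def)
  then have "sub_le H (subobject_of H n) (perp_map H f (subobject_of H m)) \<longleftrightarrow>
      i\<^sup>\<dagger> \<cdot> n = zero_arr H (Dom H n) (Dom H i)"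
    unfolding perp_map_def using sub_le_orthocomplement[OF i(1) n(1)] i(2) n(2) by simp
  also have "\<dots> \<longleftrightarrow> n\<^sup>\<dagger> \<cdot> i = zero_arr H (Dom H i) (Dom H n)"
  proof
    assume "i\<^sup>\<dagger> \<cdot> n = zero_arr H (Dom H n) (Dom H i)"
    from arg_cong[OF this, of "Dagger H"] show "n\<^sup>\<dagger> \<cdot> i = zero_arr H (Dom H i) (Dom H n)"
      using arr i n by simp
  next
    assume "n\<^sup>\<dagger> \<cdot> i = zero_arr H (Dom H i) (Dom H n)"
    from arg_cong[OF this, of "Dagger H"] show "i\<^sup>\<dagger> \<cdot> n = zero_arr H (Dom H n) (Dom H i)"
      using arr i n by simp
  qed
  also have "\<dots> \<longleftrightarrow> n\<^sup>\<dagger> \<cdot> (f \<cdot> m) = zero_arr H (Dom H m) (Dom H n)"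
  proof
    assume *: "n\<^sup>\<dagger> \<cdot> i = zero_arr H (Dom H i) (Dom H n)"
    have "n\<^sup>\<dagger> \<cdot> (f \<cdot> m) = n\<^sup>\<dagger> \<cdot> ((f \<cdot> r) \<cdot> a)"
      unfolding a(2)[symmetric] using a(1) arr(1-3) Cr m(2) n(2) f by simp
    also have "\<dots> = (n\<^sup>\<dagger> \<cdot> i) \<cdot> (e \<cdot> a)"
      unfolding e(3) using a(1) arr e(2) i(2) n(2) by simp
    also have "\<dots> = zero_arr H (Dom H m) (Dom H n)" unfolding * using a(1) arr e(2) by simp
    finally show "n\<^sup>\<dagger> \<cdot> (f \<cdot> m) = zero_arr H (Dom H m) (Dom H n)" .
  next
    assume *: "n\<^sup>\<dagger> \<cdot> (f \<cdot> m) = zero_arr H (Dom H m) (Dom H n)"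
    have "(n\<^sup>\<dagger> \<cdot> i) \<cdot> e = n\<^sup>\<dagger> \<cdot> (f \<cdot> r)" unfolding e(3) using arr e(2) i(2) n(2) by simp
    also have "\<dots> = (n\<^sup>\<dagger> \<cdot> (f \<cdot> m)) \<cdot> b"
      unfolding b(2)[symmetric] using b(1) arr m(2) n(2) f by simp
    \<comment> \<open>Zero is written as a composite with \<open>e\<close> so that the epi
      \<open>e\<close> can be cancelled.\<close>
    also have "\<dots> = zero_arr H (Dom H i) (Dom H n) \<cdot> e" unfolding * using b(1) arr e(2) by simp
    finally have "(n\<^sup>\<dagger> \<cdot> i) \<cdot> e = zero_arr H (Dom H i) (Dom H n) \<cdot> e" .
    moreover have "n\<^sup>\<dagger> \<cdot> i \<in> hom H (Cod H e) (Dom H n)"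
      "zero_arr H (Dom H i) (Dom H n) \<in> hom H (Cod H e) (Dom H n)" "Dom H n \<in> Obj H"
      using arr e(2) i(2) n(2) by simp_all
    ultimately show "n\<^sup>\<dagger> \<cdot> i = zero_arr H (Dom H i) (Dom H n)"
      using e(1) unfolding epi_arr_def by blast
  qed
  finally show ?thesis .
qed

text \<open>Both sides of the adjunction are vanishing conditions on test arrows. The dagger, taken
  on the side of \<open>f\<close>, yields a condition on \<open>f\<^sup>\<dagger>\<close>, which is
  parallel to \<open>g\<close> and can be compared with it.\<close>

lemma perp_adjointD:
  assumes "perp_adjoint H X Y f g" "f \<in> hom H X Y" "g \<in> hom H Y X"
    and m: "dagger_mono H m" "Cod H m = X" and n: "dagger_mono H n" "Cod H n = Y"
  shows "m\<^sup>\<dagger> \<cdot> (f\<^sup>\<dagger> \<cdot> n) = zero_arr H (Dom H n) (Dom H m) \<longleftrightarrow>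
    m\<^sup>\<dagger> \<cdot> (g \<cdot> n) = zero_arr H (Dom H n) (Dom H m)"
proof -
  note arr = dagger_mono_arr[OF m(1)] dagger_mono_arr[OF n(1)]
  have "m\<^sup>\<dagger> \<cdot> (f\<^sup>\<dagger> \<cdot> n) = zero_arr H (Dom H n) (Dom H m) \<longleftrightarrow>
      n\<^sup>\<dagger> \<cdot> (f \<cdot> m) = zero_arr H (Dom H m) (Dom H n)"
  proof
    assume "m\<^sup>\<dagger> \<cdot> (f\<^sup>\<dagger> \<cdot> n) = zero_arr H (Dom H n) (Dom H m)"
    from arg_cong[OF this, of "Dagger H"] show "n\<^sup>\<dagger> \<cdot> (f \<cdot> m) = zero_arr H (Dom H m) (Dom H n)"
      using arr assms(2) m(2) n(2) by simp
  next
    assume "n\<^sup>\<dagger> \<cdot> (f \<cdot> m) = zero_arr H (Dom H m) (Dom H n)"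
    from arg_cong[OF this, of "Dagger H"] show "m\<^sup>\<dagger> \<cdot> (f\<^sup>\<dagger> \<cdot> n) = zero_arr H (Dom H n) (Dom H m)"
      using arr assms(2) m(2) n(2) by simp
  qed
  also have "\<dots> \<longleftrightarrow> sub_le H (subobject_of H n) (perp_map H f (subobject_of H m))"
    using sub_le_perp_map[OF assms(2) m n] by simp
  also have "\<dots> \<longleftrightarrow> sub_le H (subobject_of H m) (perp_map H g (subobject_of H n))"
    using assms(1) subobject_of_ClSub[OF m(1)] subobject_of_ClSub[OF n(1)] m(2) n(2)
    unfolding perp_adjoint_def by blast
  also have "\<dots> \<longleftrightarrow> m\<^sup>\<dagger> \<cdot> (g \<cdot> n) = zero_arr H (Dom H n) (Dom H m)"
    using sub_le_perp_map[OF assms(3) n m] .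
  finally show ?thesis .
qed

end

section \<open>States of a simple generating unit\<close>

locale pre_hilbert_simple_generator = pre_hilbert_category H
  for H :: "('o, 'a, 'z) monoidal_dagger_category_scheme" (structure) +
  assumes generator_Unit: "generator H (Unit H)"
    and simple_Unit: "simple_object H (Unit H)"
begin

lemma arr_eqI:
  assumes "f \<in> hom H X Y" "g \<in> hom H X Y" "\<And>x. x \<in> hom H (Unit H) X \<Longrightarrow> f \<cdot> x = g \<cdot> x"
  shows "f = g"
proof -
  have "X \<in> Obj H" "Y \<in> Obj H" using assms(1) by auto
  with assms generator_Unit show ?thesis unfolding generator_def by blast
qed

text \<open>The second alternative encodes that the domain of \<open>m\<close> is a zero object: if
  \<open>m\<close> represents the zero subobject, the identity of its domain factors through a zero
  object. As an equation of arrows it can be composed directly with any arrow into that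
  domain.\<close>

lemma mono_into_Unit:
  assumes m: "mono_arr H m" "Cod H m = Unit H"
  shows "(\<exists>d\<in>hom H (Unit H) (Dom H m). m \<cdot> d = Id H (Unit H) \<and> d \<cdot> m = Id H (Dom H m)) \<or>
    Id H (Dom H m) = zero_arr H (Dom H m) (Dom H m)"
proof -
  have "subobject_of H m \<in> Sub H (Unit H)"
    using m by (auto simp: Sub_def subobject_of_def monos_into_def intro!: quotientI)
  then consider Z where "zero_object H Z" "subobject_of H m = subobject_of H (zero_arr H Z (Unit H))"
    | "subobject_of H m = subobject_of H (Id H (Unit H))"
    using simple_Unit unfolding simple_object_def by blast
  then show ?thesis
  proof cases
    case 1
    have "Z \<in> Obj H" using 1(1) by (simp add: zero_object_def)
    then have Z: "Dom H (zero_arr H Z (Unit H)) = Z" by simp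
    have "m \<in> subobject_of H (zero_arr H Z (Unit H))" using subobject_of_refl[OF m(1)] 1(2) by simp
    then obtain a b where "a \<in> hom H Z (Dom H m)" "b \<in> hom H (Dom H m) Z" "a \<cdot> b = Id H (Dom H m)"
      by (rule subobject_of_memD) (simp only: Z)
    with zero_arr_eq[OF 1(1)] show ?thesis by metis
  next
    case 2
    have "m \<in> subobject_of H (Id H (Unit H))" using subobject_of_refl[OF m(1)] 2 by simp
    then obtain a b where ab: "a \<in> hom H (Unit H) (Dom H m)" "b \<in> hom H (Dom H m) (Unit H)"
      "a \<cdot> b = Id H (Dom H m)" "m \<cdot> a = Id H (Unit H)" "Id H (Unit H) \<cdot> b = m"
      by (rule subobject_of_memD) simp
    from ab(2,5) have "b = m" by simp
    with ab(3) have "a \<cdot> m = Id H (Dom H m)" by simp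
    with ab(1,4) show ?thesis by blast
  qed
qed

text \<open>The kernel of \<open>y\<close> is a mono into the unit. Were it invertible,
  \<open>y\<close> would vanish; so by simplicity its domain is zero, and
  \<open>mono_arr_if_zero_kernel\<close> applies.\<close>

lemma state_mono:
  assumes y: "y \<in> hom H (Unit H) Y" "y \<noteq> zero_arr H (Unit H) Y"
  shows "mono_arr H y"
proof (rule mono_arr_if_zero_kernel)
  fix w assume w: "w \<in> Arr H" "Cod H w = Dom H y" "y \<cdot> w = zero_arr H (Dom H w) (Cod H y)"
  obtain k where k: "kernel H k y" "dagger_mono H k" using ex_dagger_kernel[of y] y by auto
  note kD = kernelD[OF k(1)]
  have Id: "Id H (Dom H k) = zero_arr H (Dom H k) (Dom H k)"
  proof (rule ccontr)
    assume "Id H (Dom H k) \<noteq> zero_arr H (Dom H k) (Dom H k)"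
    then obtain d where d: "d \<in> hom H (Unit H) (Dom H k)" "k \<cdot> d = Id H (Unit H)"
      using mono_into_Unit[OF dagger_mono_mono[OF k(2)]] kD(3) y by auto
    have "y \<cdot> (k \<cdot> d) = zero_arr H (Unit H) Y"
      using comp_reassoc[OF kD(4), of d] kD(1-3) d(1) y(1) by simp
    with d(2) y show False by simp
  qed
  obtain u where u: "u \<in> hom H (Dom H w) (Dom H k)" "w = k \<cdot> u" using kD(5)[OF w] by blast
  have "Id H (Dom H k) \<cdot> u = zero_arr H (Dom H w) (Dom H k)" unfolding Id using kD(1) u(1) by simp
  then have "u = zero_arr H (Dom H w) (Dom H k)" using u(1) by simp
  then have "k \<cdot> u = zero_arr H (Dom H w) (Dom H y)" using kD(1,3) w(1) by simp
  with u(2) show "w = zero_arr H (Dom H w) (Dom H y)" by (simp only:)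
qed (use y in simp)

text \<open>In the factorisation \<open>y = i \<cdot> e\<close> the arrow
  \<open>e\<^sup>\<dagger>\<close> is a mono into the unit, hence invertible as \<open>y\<close> is
  nonzero. So \<open>y\<close> spans its double orthocomplement \<open>i\<close>, through which
  \<open>z\<close> factors.\<close>

lemma state_span:
  assumes y: "y \<in> hom H (Unit H) Y" "y \<noteq> zero_arr H (Unit H) Y"
    and j: "kernel H j (y\<^sup>\<dagger>)" "dagger_mono H j"
    and z: "z \<in> hom H (Unit H) Y" "j\<^sup>\<dagger> \<cdot> z = zero_arr H (Unit H) (Dom H j)"
  shows "\<exists>t\<in>hom H (Unit H) (Unit H). z = y \<cdot> t"
proof -
  have "y \<in> Arr H" using y by simp
  from image_factorisation[OF this j] obtain i e where i: "kernel H i (j\<^sup>\<dagger>)" "Cod H i = Y"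
    and e: "mono_arr H (e\<^sup>\<dagger>)" "e \<in> hom H (Unit H) (Dom H i)" "y = i \<cdot> e" using y(1) by auto
  note iD = kernelD[OF i(1)]
  have "Id H (Dom H i) \<noteq> zero_arr H (Dom H i) (Dom H i)"
  proof
    assume "Id H (Dom H i) = zero_arr H (Dom H i) (Dom H i)"
    then have "Id H (Dom H i) \<cdot> e = zero_arr H (Unit H) (Dom H i)" using iD(1) e(2) by simp
    then have "i \<cdot> e = zero_arr H (Unit H) Y" using iD(1) e(2) i(2) by simp
    with y(2) e(3) show False by simp
  qed
  then obtain d where d: "d \<in> hom H (Unit H) (Dom H i)" "d \<cdot> e\<^sup>\<dagger> = Id H (Dom H i)"
    using mono_into_Unit[OF e(1)] e(2) by auto
  have ed: "e \<cdot> d\<^sup>\<dagger> = Id H (Dom H i)" using arg_cong[OF d(2), of "Dagger H"] d(1) e(2) iD(1) by simp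
  have "Dom H (j\<^sup>\<dagger>) = Y" "Cod H (j\<^sup>\<dagger>) = Dom H j" using iD(3) i(2) kernelD(1)[OF j(1)] by simp_all
  then obtain v where v: "v \<in> hom H (Unit H) (Dom H i)" "z = i \<cdot> v"
    using iD(5)[of z] z by auto
  \<comment> \<open>\<open>d\<^sup>\<dagger>\<close> is a right inverse of \<open>e\<close>; it
    turns the coordinate \<open>v\<close> of \<open>z\<close> along \<open>i\<close> into the scalar
    sought.\<close>
  have "y \<cdot> (d\<^sup>\<dagger> \<cdot> v) = i \<cdot> v"
    unfolding e(3) using d(1) e(2) v(1) iD(1) by (simp add: comp_reassoc[OF ed])
  with v d(1) show ?thesis by (intro bexI[of _ "d\<^sup>\<dagger> \<cdot> v"]) simp_all
qed

end

section \<open>Parallel arrows linked by preservation of orthogonality\<close>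

locale orthogonality_preserving = pre_hilbert_simple_generator H
  for H :: "('o, 'a, 'z) monoidal_dagger_category_scheme" (structure) +
  fixes X Y F G
  assumes F: "F \<in> hom H X Y" and G: "G \<in> hom H X Y"
    and orth: "dagger_mono H m \<Longrightarrow> Cod H m = Y \<Longrightarrow> dagger_mono H n \<Longrightarrow> Cod H n = X \<Longrightarrow>
      m\<^sup>\<dagger> \<cdot> (F \<cdot> n) = zero_arr H (Dom H n) (Dom H m) \<Longrightarrow>
      m\<^sup>\<dagger> \<cdot> (G \<cdot> n) = zero_arr H (Dom H n) (Dom H m)"
begin

lemma obj [simp]: "X \<in> Obj H" "Y \<in> Obj H"
  using F by auto

text \<open>\<open>orth\<close> speaks of dagger monos \<open>n\<close>, but any \<open>x\<close>
  with vanishing composite factors through the dagger kernel of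
  \<open>m\<^sup>\<dagger> \<cdot> F\<close>, to which \<open>orth\<close> applies.\<close>

lemma orth_arr:
  assumes m: "dagger_mono H m" "Cod H m = Y" and x: "x \<in> hom H W X"
    and eq: "m\<^sup>\<dagger> \<cdot> (F \<cdot> x) = zero_arr H W (Dom H m)"
  shows "m\<^sup>\<dagger> \<cdot> (G \<cdot> x) = zero_arr H W (Dom H m)"
proof -
  note m' = dagger_mono_arr[OF m(1)] m(2)
  obtain n where n: "kernel H n (m\<^sup>\<dagger> \<cdot> F)" "dagger_mono H n"
    using ex_dagger_kernel[of "m\<^sup>\<dagger> \<cdot> F"] m' F by auto
  note nD = kernelD[OF n(1)]
  have Cn: "Cod H n = X" using nD(3) m' F by simp
  have "m\<^sup>\<dagger> \<cdot> (F \<cdot> n) = zero_arr H (Dom H n) (Dom H m)"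
    using nD(4) nD(1) Cn m' F by simp
  then have *: "m\<^sup>\<dagger> \<cdot> (G \<cdot> n) = zero_arr H (Dom H n) (Dom H m)"
    using orth[OF m n(2) Cn] by simp
  obtain u where u: "u \<in> hom H W (Dom H n)" "x = n \<cdot> u"
    using nD(5)[of x] x eq m' F by auto
  have "m\<^sup>\<dagger> \<cdot> (G \<cdot> (n \<cdot> u)) = (m\<^sup>\<dagger> \<cdot> (G \<cdot> n)) \<cdot> u" using u(1) nD(1) Cn m' G by simp
  also have "\<dots> = zero_arr H W (Dom H m)" unfolding * using u(1) nD(1) m'(1) by simp
  finally show ?thesis using u(2) by (simp only:)
qed

text \<open>Being orthogonal to all of \<open>Y\<close> is being zero, so the identity of
  \<open>Y\<close> serves as \<open>m\<close>.\<close>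

lemma zero_preserving:
  assumes x: "x \<in> hom H W X" "F \<cdot> x = zero_arr H W Y"
  shows "G \<cdot> x = zero_arr H W Y"
proof -
  have "dagger_mono H (Id H Y)" by (simp add: dagger_mono_def)
  moreover have "W \<in> Obj H" using x(1) by auto
  ultimately show ?thesis using orth_arr[of "Id H Y" x W] x G by simp
qed

text \<open>Let \<open>j\<close> be the orthocomplement of a nonzero state
  \<open>F \<cdot> x\<close>. Then \<open>G \<cdot> x\<close> is orthogonal to \<open>j\<close> too,
  and \<open>state_span\<close> makes it a multiple of \<open>F \<cdot> x\<close>.\<close>

lemma ex_state_scalar:
  assumes x: "x \<in> hom H (Unit H) X"
  shows "\<exists>t\<in>hom H (Unit H) (Unit H). G \<cdot> x = F \<cdot> x \<cdot> t"
proof (cases "F \<cdot> x = zero_arr H (Unit H) Y")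
  case True
  \<comment> \<open>Both sides vanish, so any scalar would do; the identity is taken.\<close>
  with zero_preserving[OF x True] show ?thesis
    by (intro bexI[of _ "Id H (Unit H)"]) simp_all
next
  case False
  have Fx: "F \<cdot> x \<in> hom H (Unit H) Y" using F x by simp
  have Gx: "G \<cdot> x \<in> hom H (Unit H) Y" using G x by simp
  obtain j where j: "kernel H j ((F \<cdot> x)\<^sup>\<dagger>)" "dagger_mono H j"
    using ex_dagger_kernel[of "(F \<cdot> x)\<^sup>\<dagger>"] Fx by auto
  note jD = kernelD[OF j(1)]
  have Cj: "Cod H j = Y" using jD(3) Fx by simp
  have "((F \<cdot> x)\<^sup>\<dagger> \<cdot> j)\<^sup>\<dagger> = j\<^sup>\<dagger> \<cdot> (F \<cdot> x)" using jD(1) Fx Cj F x by simp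
  also have "((F \<cdot> x)\<^sup>\<dagger> \<cdot> j)\<^sup>\<dagger> = zero_arr H (Unit H) (Dom H j)"
    unfolding jD(4) using jD(1) Fx by simp
  finally have "j\<^sup>\<dagger> \<cdot> (F \<cdot> x) = zero_arr H (Unit H) (Dom H j)" by simp
  from state_span[OF Fx False j Gx orth_arr[OF j(2) Cj x this]] show ?thesis .
qed

text \<open>For vector spaces one compares the scalars at \<open>x\<close>, \<open>y\<close> and
  \<open>x + y\<close>. Here the copairing \<open>c\<close> replaces the sum, and if
  \<open>F \<cdot> x\<close> and \<open>F \<cdot> y\<close> are dependent, a nonzero state in the
  kernel of \<open>F \<cdot> c\<close> records their relation.\<close>

lemma state_scalar_unique:
  assumes x: "x \<in> hom H (Unit H) X" "F \<cdot> x \<noteq> zero_arr H (Unit H) Y"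
    and y: "y \<in> hom H (Unit H) X" "F \<cdot> y \<noteq> zero_arr H (Unit H) Y"
    and s: "s \<in> hom H (Unit H) (Unit H)" "G \<cdot> x = F \<cdot> x \<cdot> s"
    and t: "t \<in> hom H (Unit H) (Unit H)" "G \<cdot> y = F \<cdot> y \<cdot> t"
  shows "s = t"
proof -
  let ?C = "Unit H"
  obtain B p q where "biproduct H ?C ?C B p q (p\<^sup>\<dagger>) (q\<^sup>\<dagger>)"
    using dagger_biproduct_exists[of ?C ?C] by auto
  then have prod: "product_cone H ?C ?C B p q" and coprod: "coproduct_cocone H ?C ?C B (p\<^sup>\<dagger>) (q\<^sup>\<dagger>)"
    and pq: "p \<cdot> p\<^sup>\<dagger> = Id H ?C" "q \<cdot> q\<^sup>\<dagger> = Id H ?C" "q \<cdot> p\<^sup>\<dagger> = zero_arr H ?C ?C" "p \<cdot> q\<^sup>\<dagger> = zero_arr H ?C ?C"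
    unfolding biproduct_def by simp_all
  have arr: "p \<in> hom H B ?C" "q \<in> hom H B ?C" using prod unfolding product_cone_def by blast+
  then have arr' [simp]: "p \<in> Arr H" "Dom H p = B" "Cod H p = ?C" "q \<in> Arr H" "Dom H q = B" "Cod H q = ?C"
    and B [simp]: "B \<in> Obj H" by auto
  have prod_ext: "u = v" if "u \<in> hom H W B" "v \<in> hom H W B" "p \<cdot> u = p \<cdot> v" "q \<cdot> u = q \<cdot> v" for u v W
  proof -
    have "W \<in> Obj H" "p \<cdot> v \<in> hom H W ?C" "q \<cdot> v \<in> hom H W ?C" using that(1,2) by auto
    with prod that show ?thesis unfolding product_cone_def by blast
  qed
  have coprod_ext: "u = v" if "u \<in> hom H B W" "v \<in> hom H B W" "u \<cdot> p\<^sup>\<dagger> = v \<cdot> p\<^sup>\<dagger>" "u \<cdot> q\<^sup>\<dagger> = v \<cdot> q\<^sup>\<dagger>" for u v W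
  proof -
    have "W \<in> Obj H" "v \<cdot> p\<^sup>\<dagger> \<in> hom H ?C W" "v \<cdot> q\<^sup>\<dagger> \<in> hom H ?C W" using that(1,2) by auto
    with coprod that show ?thesis unfolding coproduct_cocone_def by blast
  qed
  obtain c where c: "c \<in> hom H B X" "c \<cdot> p\<^sup>\<dagger> = x" "c \<cdot> q\<^sup>\<dagger> = y"
    using coprod x(1) y(1) obj unfolding coproduct_cocone_def by blast
  have "p\<^sup>\<dagger> \<cdot> s \<in> hom H ?C B" "q\<^sup>\<dagger> \<cdot> t \<in> hom H ?C B" using s(1) t(1) by simp_all
  then obtain D where D: "D \<in> hom H B B" "D \<cdot> p\<^sup>\<dagger> = p\<^sup>\<dagger> \<cdot> s" "D \<cdot> q\<^sup>\<dagger> = q\<^sup>\<dagger> \<cdot> t"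
    using coprod B unfolding coproduct_cocone_def by blast
  \<comment> \<open>This and the next two equations are checked on the injections of the
    biproduct.\<close>
  have pD: "p \<cdot> D = s \<cdot> p"
    by (rule coprod_ext[of _ ?C]) (use s(1) t(1) D(1) in \<open>simp_all add: D(2,3) pq comp_reassoc[OF pq(1)] comp_reassoc[OF pq(4)]\<close>)
  have qD: "q \<cdot> D = t \<cdot> q"
    by (rule coprod_ext[of _ ?C]) (use s(1) t(1) D(1) in \<open>simp_all add: D(2,3) pq comp_reassoc[OF pq(2)] comp_reassoc[OF pq(3)]\<close>)
  have GcD: "G \<cdot> c = F \<cdot> (c \<cdot> D)"
    by (rule coprod_ext[of _ Y]) (use s t(1) c(1) D(1) F G x(1) y(1) t(2) in \<open>simp_all add: D(2,3) c(2,3) comp_reassoc[OF c(2)] comp_reassoc[OF c(3)]\<close>)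
  have GF: "G \<cdot> (c \<cdot> z) = F \<cdot> (c \<cdot> (D \<cdot> z))" if "z \<in> hom H W B" for z W
    using comp_reassoc[OF GcD, of z] that c(1) D(1) F G by simp
  have mono: "mono_arr H (F \<cdot> x)" "mono_arr H (F \<cdot> y)"
    using state_mono[OF _ x(2)] state_mono[OF _ y(2)] F x(1) y(1) by simp_all
  \<comment> \<open>\<open>D\<close> is the diagonal matrix with entries \<open>s\<close> and \<open>t\<close>.\<close>
  show ?thesis
  proof (cases "\<forall>z\<in>hom H ?C B. F \<cdot> (c \<cdot> z) = zero_arr H ?C Y \<longrightarrow> z = zero_arr H ?C B")
    case True
    \<comment> \<open>The case assumption concerns states only. As the unit is a generator, an arrow
      \<open>w\<close> killed by \<open>F \<cdot> c\<close> is zero once all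
      \<open>w \<cdot> v\<close> with states \<open>v\<close> are.\<close>
    have Fc: "mono_arr H (F \<cdot> c)"
    proof (rule mono_arr_if_zero_kernel)
      fix w assume w: "w \<in> Arr H" "Cod H w = Dom H (F \<cdot> c)"
        and eq: "(F \<cdot> c) \<cdot> w = zero_arr H (Dom H w) (Cod H (F \<cdot> c))"
      have wB: "Cod H w = B" using w(2) F c(1) by simp
      have "w = zero_arr H (Dom H w) B"
      proof (rule arr_eqI)
        fix v assume v: "v \<in> hom H ?C (Dom H w)"
        have "F \<cdot> (c \<cdot> (w \<cdot> v)) = zero_arr H ?C Y"
          using comp_reassoc[OF eq, of v] v w(1) wB F c(1) by simp
        moreover have "w \<cdot> v \<in> hom H ?C B" using v w(1) wB by simp
        ultimately have "w \<cdot> v = zero_arr H ?C B" using True by blast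
        then show "w \<cdot> v = zero_arr H (Dom H w) B \<cdot> v" using v w(1) by simp
      qed (use w(1) wB in simp_all)
      then show "w = zero_arr H (Dom H w) (Dom H (F \<cdot> c))" using F c(1) by simp
    qed (use F c(1) in simp)
    obtain d where d: "d \<in> hom H ?C B" "p \<cdot> d = Id H ?C" "q \<cdot> d = Id H ?C"
      using prod Unit_Obj Id_hom[OF Unit_Obj] unfolding product_cone_def by blast
    have "c \<cdot> d \<in> hom H ?C X" using c(1) d(1) by simp
    \<comment> \<open>\<open>c \<cdot> d\<close> plays the role of \<open>x + y\<close>. Its single
      scalar \<open>r\<close> is identified with \<open>s\<close> by the projection \<open>p\<close>
      and with \<open>t\<close> by \<open>q\<close>.\<close>
    then obtain r where r: "r \<in> hom H ?C ?C" "G \<cdot> (c \<cdot> d) = F \<cdot> (c \<cdot> d) \<cdot> r"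
      using ex_state_scalar by blast
    have "(F \<cdot> c) \<cdot> (D \<cdot> d) = (F \<cdot> c) \<cdot> (d \<cdot> r)"
      using GF[OF d(1)] r c(1) d(1) D(1) F by simp
    then have Dd: "D \<cdot> d = d \<cdot> r"
      by (rule mono_arr_cancel[OF Fc, of _ ?C, rotated 2]) (use c(1) d(1) D(1) F r(1) in simp_all)
    have "s = (s \<cdot> p) \<cdot> d" using s(1) d(1) by (simp add: d(2))
    also have "\<dots> = p \<cdot> (D \<cdot> d)" by (rule comp_reassoc[OF pD, symmetric]) (use d(1) D(1) in simp_all)
    also have "\<dots> = r" unfolding Dd using comp_reassoc[OF d(2), of r] d(1) r(1) by simp
    finally have "s = r" .
    have "t = (t \<cdot> q) \<cdot> d" using t(1) d(1) by (simp add: d(3))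
    also have "\<dots> = q \<cdot> (D \<cdot> d)" by (rule comp_reassoc[OF qD, symmetric]) (use d(1) D(1) in simp_all)
    also have "\<dots> = r" unfolding Dd using comp_reassoc[OF d(3), of r] d(1) r(1) by simp
    finally show ?thesis using \<open>s = r\<close> by simp
  next
    case False
    then obtain z where z: "z \<in> hom H ?C B" "F \<cdot> (c \<cdot> z) = zero_arr H ?C Y" "z \<noteq> zero_arr H ?C B"
      by blast
    \<comment> \<open>\<open>G\<close> kills what \<open>F\<close> kills, so \<open>D\<close> keeps
      \<open>z\<close> in the kernel of \<open>F \<cdot> c\<close>.\<close>
    have FDz: "F \<cdot> (c \<cdot> (D \<cdot> z)) = zero_arr H ?C Y"
      using zero_preserving[of "c \<cdot> z" ?C] GF[OF z(1)] z c(1) by simp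
    obtain k where k: "kernel H k (F \<cdot> c)" "dagger_mono H k"
      using ex_dagger_kernel[of "F \<cdot> c"] F c(1) by auto
    note kD = kernelD[OF k(1)]
    have kB: "Cod H k = B" using kD(3) F c(1) by simp
    have Fck: "F \<cdot> (c \<cdot> k) = zero_arr H (Dom H k) Y" using kD(1,4) kB F c(1) by simp
    obtain u where u: "u \<in> hom H ?C (Dom H k)" "z = k \<cdot> u"
      using kD(5)[of z] z F c(1) by auto
    obtain u' where u': "u' \<in> hom H ?C (Dom H k)" "D \<cdot> z = k \<cdot> u'"
      using kD(5)[of "D \<cdot> z"] z(1) FDz F c(1) D(1) by auto
    \<comment> \<open>A kernel element without \<open>p\<close>-component lies in the second
      summand, on which \<open>F \<cdot> c\<close> is the mono \<open>F \<cdot> y\<close>.\<close>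
    have pk: "mono_arr H (p \<cdot> k)"
    proof (rule mono_arr_if_zero_kernel)
      fix w assume w: "w \<in> Arr H" "Cod H w = Dom H (p \<cdot> k)"
        and eq: "(p \<cdot> k) \<cdot> w = zero_arr H (Dom H w) (Cod H (p \<cdot> k))"
      have wk: "Cod H w = Dom H k" using w(2) kD(1) kB by simp
      have pkw: "p \<cdot> (k \<cdot> w) = zero_arr H (Dom H w) ?C" using eq w(1) wk kD(1) kB by simp
      \<comment> \<open>In place of a sum decomposition of the identity, both projections are
        compared; the \<open>p\<close>-components vanish on either side.\<close>
      have kw: "k \<cdot> w = q\<^sup>\<dagger> \<cdot> (q \<cdot> (k \<cdot> w))"
        by (rule prod_ext[of _ "Dom H w"]) (use w(1) wk kD(1) kB pkw in \<open>simp_all add: comp_reassoc[OF pq(2)] comp_reassoc[OF pq(4)]\<close>)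
      have "(F \<cdot> y) \<cdot> (q \<cdot> (k \<cdot> w)) = F \<cdot> (c \<cdot> (q\<^sup>\<dagger> \<cdot> (q \<cdot> (k \<cdot> w))))"
        unfolding c(3)[symmetric] using F c(1) w(1) wk kD(1) kB by simp
      also have "\<dots> = (F \<cdot> (c \<cdot> k)) \<cdot> w"
        unfolding kw[symmetric] using F c(1) w(1) wk kD(1) kB by simp
      also have "\<dots> = zero_arr H (Dom H w) Y" unfolding Fck using w(1) wk by simp
      finally have "q \<cdot> (k \<cdot> w) = zero_arr H (Dom H w) ?C"
        using mono_arr_zero_cancel[OF mono(2), of "q \<cdot> (k \<cdot> w)" "Dom H w"] F y(1) w(1) wk kD(1) kB by simp
      then have "q\<^sup>\<dagger> \<cdot> (q \<cdot> (k \<cdot> w)) = zero_arr H (Dom H w) B" using w(1) by simp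
      then have "k \<cdot> w = zero_arr H (Dom H w) B" unfolding kw[symmetric] .
      then have "w = zero_arr H (Dom H w) (Dom H k)"
        using mono_arr_zero_cancel[OF dagger_mono_mono[OF k(2)], of w "Dom H w"] w(1) wk kB by simp
      then show "w = zero_arr H (Dom H w) (Dom H (p \<cdot> k))" using kD(1) kB by simp
    qed (use kD(1) kB in simp)
    have pz: "p \<cdot> z \<in> hom H ?C ?C" "q \<cdot> z \<in> hom H ?C ?C" using z(1) by simp_all
    \<comment> \<open>\<open>D \<cdot> z\<close> and \<open>z \<cdot> s\<close> have the same
      \<open>p\<close>-component because scalars commute, and kernel elements are determined by that
      component.\<close>
    have "(p \<cdot> k) \<cdot> u' = p \<cdot> (D \<cdot> z)" unfolding u'(2) using u'(1) kD(1) kB by simp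
    also have "\<dots> = (s \<cdot> p) \<cdot> z" by (rule comp_reassoc[OF pD]) (use z(1) D(1) in simp_all)
    also have "\<dots> = s \<cdot> (p \<cdot> z)" using z(1) s(1) by simp
    also have "\<dots> = (p \<cdot> z) \<cdot> s" using scalar_commute[OF s(1) pz(1)] .
    also have "\<dots> = (p \<cdot> k) \<cdot> (u \<cdot> s)" unfolding u(2) using u(1) kD(1) kB s(1) by simp
    finally have "u' = u \<cdot> s"
      by (rule mono_arr_cancel[OF pk, of _ ?C, rotated 2]) (use u(1) u'(1) s(1) kD(1) kB in simp_all)
    then have Dz: "D \<cdot> z = (k \<cdot> u) \<cdot> s" unfolding u'(2) using u(1) kD(1) s(1) by simp
    have Dz: "D \<cdot> z = z \<cdot> s" unfolding Dz u(2)[symmetric] ..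
    \<comment> \<open>On the \<open>q\<close>-component \<open>D\<close> acts by \<open>t\<close>,
      so projecting \<open>D \<cdot> z = z \<cdot> s\<close> compares \<open>s\<close> with
      \<open>t\<close>.\<close>
    have "(q \<cdot> z) \<cdot> s = q \<cdot> (D \<cdot> z)" unfolding Dz using z(1) s(1) by simp
    also have "\<dots> = (t \<cdot> q) \<cdot> z" by (rule comp_reassoc[OF qD]) (use z(1) D(1) in simp_all)
    also have "\<dots> = t \<cdot> (q \<cdot> z)" using z(1) t(1) by simp
    also have "\<dots> = (q \<cdot> z) \<cdot> t" using scalar_commute[OF t(1) pz(2)] .
    finally have eq: "(q \<cdot> z) \<cdot> s = (q \<cdot> z) \<cdot> t" .
    have Dqz: "Dom H (q \<cdot> z) = ?C" using z(1) by simp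
    \<comment> \<open>Otherwise \<open>z\<close> lies in the first summand, on which
      \<open>F \<cdot> c\<close> is the mono \<open>F \<cdot> x\<close>, and would be zero.\<close>
    have "q \<cdot> z \<noteq> zero_arr H ?C ?C"
    proof
      assume qz: "q \<cdot> z = zero_arr H ?C ?C"
      have zp: "z = p\<^sup>\<dagger> \<cdot> (p \<cdot> z)"
        by (rule prod_ext[of _ ?C]) (use z(1) qz in \<open>simp_all add: comp_reassoc[OF pq(1)] comp_reassoc[OF pq(3)]\<close>)
      have "(F \<cdot> x) \<cdot> (p \<cdot> z) = F \<cdot> (c \<cdot> (p\<^sup>\<dagger> \<cdot> (p \<cdot> z)))"
        unfolding c(2)[symmetric] using F c(1) z(1) by simp
      also have "\<dots> = zero_arr H ?C Y" unfolding zp[symmetric] by (fact z(2))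
      finally have "p \<cdot> z = zero_arr H ?C ?C"
        using mono_arr_zero_cancel[OF mono(1), of "p \<cdot> z" ?C] F x(1) z(1) by simp
      then have "p\<^sup>\<dagger> \<cdot> (p \<cdot> z) = zero_arr H ?C B" by simp
      with zp z(3) show False by simp
    qed
    with pz(2) have "mono_arr H (q \<cdot> z)" by (rule state_mono)
    then show ?thesis
      by (rule mono_arr_cancel[OF _ _ _ eq, of ?C]) (use s(1) t(1) Dqz in simp_all)
  qed
qed

text \<open>All states share one scalar \<open>t\<close>, which \<open>ex_scalar_mult_id\<close>
  writes as \<open>s \<bullet> Id H (Unit H)\<close>; agreement on states is then equality since the
  unit is a generator.\<close>

lemma ex_scalar: "\<exists>s\<in>hom H (Unit H) (Unit H). G = s \<bullet> F"
proof -
  let ?C = "Unit H"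
  have "\<exists>t\<in>hom H ?C ?C. \<forall>x\<in>hom H ?C X. G \<cdot> x = F \<cdot> x \<cdot> t"
  proof (cases "\<exists>x\<in>hom H ?C X. F \<cdot> x \<noteq> zero_arr H ?C Y")
    case True
    then obtain x where x: "x \<in> hom H ?C X" "F \<cdot> x \<noteq> zero_arr H ?C Y" by blast
    obtain t where t: "t \<in> hom H ?C ?C" "G \<cdot> x = F \<cdot> x \<cdot> t" using ex_state_scalar[OF x(1)] by blast
    have "G \<cdot> y = F \<cdot> y \<cdot> t" if y: "y \<in> hom H ?C X" for y
    proof (cases "F \<cdot> y = zero_arr H ?C Y")
      case True
      with zero_preserving[OF y True] t(1) show ?thesis by simp
    next
      case False
      with ex_state_scalar[OF y] state_scalar_unique[OF x y _ t] show ?thesis by blast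
    qed
    with t(1) show ?thesis by blast
  next
    case False
    \<comment> \<open>Here \<open>F\<close>, and hence \<open>G\<close>, kills every state, so the
      identity serves as the common scalar.\<close>
    then have "\<forall>x\<in>hom H ?C X. G \<cdot> x = F \<cdot> x \<cdot> Id H ?C" using zero_preserving by simp
    then show ?thesis using Id_hom[OF Unit_Obj] by blast
  qed
  then obtain t where t: "t \<in> hom H ?C ?C" "\<And>x. x \<in> hom H ?C X \<Longrightarrow> G \<cdot> x = F \<cdot> x \<cdot> t" by blast
  obtain s where s: "s \<in> hom H ?C ?C" "s \<bullet> Id H ?C = t" using ex_scalar_mult_id[OF t(1)] by blast
  have "G = s \<bullet> F"
  proof (rule arr_eqI[OF G])
    show "s \<bullet> F \<in> hom H X Y" using F s(1) by simp
    fix x assume x: "x \<in> hom H ?C X"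
    then show "G \<cdot> x = (s \<bullet> F) \<cdot> x"
      using t(2)[OF x] scalar_mult_comp[of F s x] F s by simp
  qed
  with s(1) show ?thesis by blast
qed

end

section \<open>Uniqueness of the scalar and conclusion\<close>

context pre_hilbert_simple_generator
begin

text \<open>As the unit is a generator, a nonzero \<open>f\<close> is nonzero on some state
  \<open>x\<close>; then \<open>f \<cdot> x\<close> is mono and cancels from the equation evaluated
  at \<open>x\<close>.\<close>

lemma scalar_mult_inject:
  assumes f: "f \<in> hom H X Y" "f \<noteq> zero_arr H X Y"
    and s: "s \<in> hom H (Unit H) (Unit H)" and t: "t \<in> hom H (Unit H) (Unit H)"
    and eq: "s \<bullet> f = t \<bullet> f"
  shows "s = t"
proof -
  let ?C = "Unit H"
  have X: "X \<in> Obj H" "Y \<in> Obj H" using f(1) by auto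
  obtain x where x: "x \<in> hom H ?C X" "f \<cdot> x \<noteq> zero_arr H ?C Y"
    using arr_eqI[OF f(1), of "zero_arr H X Y"] f(2) X by auto
  have fx: "f \<cdot> x \<in> hom H ?C Y" using f(1) x(1) by simp
  have comp: "(r \<bullet> f) \<cdot> x = (f \<cdot> x) \<cdot> (r \<bullet> Id H ?C)" if "r \<in> hom H ?C ?C" for r
    by (rule scalar_mult_comp) (use f(1) x(1) that in simp_all)
  have "(f \<cdot> x) \<cdot> (s \<bullet> Id H ?C) = (f \<cdot> x) \<cdot> (t \<bullet> Id H ?C)"
    using comp[OF s] comp[OF t] unfolding eq by (rule trans[OF sym])
  then have "s \<bullet> Id H ?C = t \<bullet> Id H ?C"
    by (rule mono_arr_cancel[OF state_mono[OF fx x(2)], of _ ?C, rotated 2]) (use s t f(1) x(1) in simp_all)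
  then show ?thesis by (rule scalar_mult_id_inject[OF s t])
qed

end

theorem theorem5:
  fixes H :: "('o, 'a, 'z) monoidal_dagger_category_scheme"
  assumes "pre_hilbert_category H"
    and "generator H (Unit H)"
    and "simple_object H (Unit H)"
    and "X \<in> Obj H" and "Y \<in> Obj H"
    and "f \<in> hom H X Y" and "g \<in> hom H Y X"
    and "perp_adjoint H X Y f g"
  shows "(\<exists>s\<in>hom H (Unit H) (Unit H). g = s \<bullet>\<^bsub>H\<^esub> f\<^sup>\<dagger>\<^bsub>H\<^esub>) \<and>
    (f \<noteq> zero_arr H X Y \<longrightarrow>
      (\<exists>!s. s \<in> hom H (Unit H) (Unit H) \<and> g = s \<bullet>\<^bsub>H\<^esub> f\<^sup>\<dagger>\<^bsub>H\<^esub>))"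
proof -
  interpret pre_hilbert_category H by fact
  interpret pre_hilbert_simple_generator H by unfold_locales fact+
  have f': "f\<^sup>\<dagger>\<^bsub>H\<^esub> \<in> hom H Y X" using Dagger_hom[OF assms(6)] .
  \<comment> \<open>\<open>f\<^sup>\<dagger>\<close> and \<open>g\<close> both run from
    \<open>Y\<close> to \<open>X\<close>, so the two objects trade places.\<close>
  interpret orthogonality_preserving H Y X "f\<^sup>\<dagger>\<^bsub>H\<^esub>" g
    using f' assms(7) perp_adjointD[OF assms(8,6,7)] by unfold_locales blast+
  have inject: "s = t"
    if "f \<noteq> zero_arr H X Y" "s \<in> hom H (Unit H) (Unit H)" "g = s \<bullet>\<^bsub>H\<^esub> f\<^sup>\<dagger>\<^bsub>H\<^esub>"
      "t \<in> hom H (Unit H) (Unit H)" "g = t \<bullet>\<^bsub>H\<^esub> f\<^sup>\<dagger>\<^bsub>H\<^esub>" for s t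
  proof (rule scalar_mult_inject[OF f' _ that(2,4)])
    show "f\<^sup>\<dagger>\<^bsub>H\<^esub> \<noteq> zero_arr H Y X" using dagger_eq_zero_arr[of f] assms(6) that(1) by auto
    show "s \<bullet>\<^bsub>H\<^esub> f\<^sup>\<dagger>\<^bsub>H\<^esub> = t \<bullet>\<^bsub>H\<^esub> f\<^sup>\<dagger>\<^bsub>H\<^esub>" using that(3,5) by simp
  qed
  with ex_scalar show ?thesis by blast
qed

end
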